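(* Let $G$ be a finitely generated group and let $X$ be a Cayley graph of $G$ such that $$\mathcal{C}_1^X(G)=\mathrm{Comm}_{\mathrm{Aut}(X)}(G)\cap \mathrm{Aut}_1(X)$$ is not locally finite. Let $D_G$ be the largest subgroup of $G$ that is normalised by $\mathrm{Comm}_{\mathrm{Aut}(X)}(G)$. Then $G/D_G$ is residually infinite bireversible, i.e. for every $g\in G$ with $g\notin D_G$, there exists a normal subgroup $N\trianglelefteq G$ with $D_G\leq N$ such that $g\notin N$ and $G/N$ is an infinite bireversible group.
   Context: Cayley graphs. For a group $G$ with finite generating set $S$, the (unlabelled) Cayley graph $\mathrm{Cay}(G,S)$ is the directed graph with vertex set $G$ and edge set $\{(g,gs)\mid g\in G, s\in S\cup S^{-1}\}$. A Cayley graph of $G$ means $\mathrm{Cay}(G,S)$ for some finite generating set $S$. $\mathrm{Aut}(X)$ is the group of automorphisms of $X$ as an unlabelled graph, $\mathrm{Aut}_1(X)$ is the stabiliser of the vertex $1\in G$, and $G$ is regarded as a subgroup of $\mathrm{Aut}(X)$ through left multiplication. Commensurator. For $H\leq K$, $\mathrm{Comm}_K(H)=\{k\in K\mid [H:H\cap kHk^{-1}]<\infty,\ [kHk^{-1}:H\cap kHk^{-1}]<\infty\}$. A group is locally finite if all its finitely generated subgroups are finite. Bireversible groups. A Mealy automaton is a tuple $\mathcal{M}=(A,Q,\lambda,\rho)$ where $A$ (alphabet) and $Q$ (state set) are finite sets and $\lambda\colon Q\times A\to A$, $\rho\colon Q\times A\to Q$ are maps. It is invertible if $\lambda_q\colon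 A\to A$, $a\mapsto\lambda(q,a)$ is a bijection for every $q\in Q$; reversible if $\rho_a\colon Q\to Q$, $q\mapsto \rho(q,a)$ is a bijection for every $a\in A$; bireversible if it is invertible, reversible and $Q\times A\to A\times Q$, $(q,a)\mapsto(\lambda(q,a),\rho(q,a))$ is a bijection. Let $A^*$ be the free monoid on $A$. Each $\lambda_q$ extends to $A^*$ by $\lambda_q(aw)=\lambda_q(a)\lambda_{\rho(q,a)}(w)$. If $\mathcal{M}$ is invertible, these are bijections of $A^*$, giving a homomorphism $f_Q$ from the free group $F_Q$ to the group of bijections of $A^*$ (acting on the left), and the group generated by $\mathcal{M}$ is $G_{\mathcal{M}}=F_Q/\ker(f_Q)$. A group is called bireversible if it is isomorphic to $G_{\mathcal{M}}$ for some bireversible automaton $\mathcal{M}$. *)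

theory Defs
  imports
    "HOL-Algebra.Group_Action"
    "HOL-Algebra.Generated_Groups"
    "Graph_Theory.Pair_Digraph"
begin

section \<open>Cayley graphs and their automorphisms\<close>

definition cayley_graph :: "('a, 'b) monoid_scheme \<Rightarrow> 'a set \<Rightarrow> 'a pair_pre_digraph" where
  "cayley_graph G S =
     \<lparr> pverts = carrier G,
       parcs = {(g, g \<otimes>\<^bsub>G\<^esub> s) | g s. g \<in> carrier G \<and> s \<in> S \<union> m_inv G ` S} \<rparr>"

text \<open>Elements of \<open>BijGroup V\<close> are extensional functions, composed as left actions.\<close>

definition aut_group :: "'a pair_pre_digraph \<Rightarrow> ('a \<Rightarrow> 'a) monoid" where
  "aut_group X = (BijGroup (pverts X))
     \<lparr>carrier := {f \<in> Bij (pverts X). \<forall>u\<in>pverts X. \<forall>v\<in>pverts X.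
                    (f u, f v) \<in> parcs X \<longleftrightarrow> (u, v) \<in> parcs X}\<rparr>"

definition left_mult :: "('a, 'b) monoid_scheme \<Rightarrow> 'a \<Rightarrow> 'a \<Rightarrow> 'a" where
  "left_mult G g = (\<lambda>h\<in>carrier G. g \<otimes>\<^bsub>G\<^esub> h)"


section \<open>Commensurators and local finiteness\<close>

definition finite_index :: "('a, 'b) monoid_scheme \<Rightarrow> 'a set \<Rightarrow> 'a set \<Rightarrow> bool" where
  "finite_index K H L \<longleftrightarrow> finite (rcosets\<^bsub>K\<lparr>carrier := H\<rparr>\<^esub> L)"

definition commensurator :: "('a, 'b) monoid_scheme \<Rightarrow> 'a set \<Rightarrow> 'a set" where
  "commensurator K H = {k \<in> carrier K.
     let H' = k <#\<^bsub>K\<^esub> H #>\<^bsub>K\<^esub> inv\<^bsub>K\<^esub> k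
     in finite_index K H (H \<inter> H') \<and> finite_index K H' (H \<inter> H')}"

definition locally_finite_group :: "('a, 'b) monoid_scheme \<Rightarrow> bool" where
  "locally_finite_group K \<longleftrightarrow> (\<forall>F. F \<subseteq> carrier K \<and> finite F \<longrightarrow> finite (generate K F))"

definition cayley_comm :: "('a, 'b) monoid_scheme \<Rightarrow> 'a set \<Rightarrow> ('a \<Rightarrow> 'a) set" where
  "cayley_comm G S =
     commensurator (aut_group (cayley_graph G S)) (left_mult G ` carrier G)"

definition cayley_comm_stab :: "('a, 'b) monoid_scheme \<Rightarrow> 'a set \<Rightarrow> ('a \<Rightarrow> 'a) set" where
  "cayley_comm_stab G S =
     cayley_comm G S \<inter> stabilizer (aut_group (cayley_graph G S)) (\<lambda>f. f) \<one>\<^bsub>G\<^esub>"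

definition comm_normalised :: "('a, 'b) monoid_scheme \<Rightarrow> 'a set \<Rightarrow> 'a set \<Rightarrow> bool" where
  "comm_normalised G S D \<longleftrightarrow> subgroup D G \<and>
     cayley_comm G S \<subseteq> normalizer (aut_group (cayley_graph G S)) (left_mult G ` D)"

text \<open>Largest with respect to inclusion; \<open>D_subgroup_greatest\<close> below shows that it exists.\<close>

definition D_subgroup :: "('a, 'b) monoid_scheme \<Rightarrow> 'a set \<Rightarrow> 'a set" where
  "D_subgroup G S = (GREATEST D. comm_normalised G S D)"


section \<open>Free groups\<close>

text \<open>The letter \<open>(q, True)\<close> stands for the generator \<open>q\<close> and \<open>(q, False)\<close> for its inverse;
  group elements are the reduced words.\<close>

definition inv_letter :: "'q \<times> bool \<Rightarrow> 'q \<times> bool" where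
  "inv_letter x = (fst x, \<not> snd x)"

definition reduced :: "('q \<times> bool) list \<Rightarrow> bool" where
  "reduced w \<longleftrightarrow> successively (\<lambda>x y. y \<noteq> inv_letter x) w"

definition cancel_cons :: "'q \<times> bool \<Rightarrow> ('q \<times> bool) list \<Rightarrow> ('q \<times> bool) list" where
  "cancel_cons x w = (if w \<noteq> [] \<and> hd w = inv_letter x then tl w else x # w)"

definition free_group :: "'q set \<Rightarrow> ('q \<times> bool) list monoid" where
  "free_group Q = \<lparr>carrier = {w \<in> lists (Q \<times> UNIV). reduced w},
                   monoid.mult = (\<lambda>v w. foldr cancel_cons v w), one = []\<rparr>"

definition free_hom ::
    "('a, 'b) monoid_scheme \<Rightarrow> ('q \<Rightarrow> 'a) \<Rightarrow> ('q \<times> bool) list \<Rightarrow> 'a" where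
  "free_hom K \<phi> w =
     foldr (\<lambda>(q, b) k. (if b then \<phi> q else inv\<^bsub>K\<^esub> (\<phi> q)) \<otimes>\<^bsub>K\<^esub> k) w \<one>\<^bsub>K\<^esub>"


section \<open>Bireversible automata and groups\<close>

record ('q, 'a) mealy =
  alphabet :: "'a set"
  states :: "'q set"
  out_letter :: "'q \<Rightarrow> 'a \<Rightarrow> 'a"
  next_state :: "'q \<Rightarrow> 'a \<Rightarrow> 'q"

definition mealy_automaton :: "('q, 'a) mealy \<Rightarrow> bool" where
  "mealy_automaton M \<longleftrightarrow> finite (alphabet M) \<and> finite (states M) \<and>
     out_letter M \<in> states M \<rightarrow> alphabet M \<rightarrow> alphabet M \<and>
     next_state M \<in> states M \<rightarrow> alphabet M \<rightarrow> states M"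

definition invertible_mealy :: "('q, 'a) mealy \<Rightarrow> bool" where
  "invertible_mealy M \<longleftrightarrow>
     (\<forall>q\<in>states M. bij_betw (\<lambda>a. out_letter M q a) (alphabet M) (alphabet M))"

definition reversible_mealy :: "('q, 'a) mealy \<Rightarrow> bool" where
  "reversible_mealy M \<longleftrightarrow>
     (\<forall>a\<in>alphabet M. bij_betw (\<lambda>q. next_state M q a) (states M) (states M))"

definition bireversible_mealy :: "('q, 'a) mealy \<Rightarrow> bool" where
  "bireversible_mealy M \<longleftrightarrow>
     mealy_automaton M \<and> invertible_mealy M \<and> reversible_mealy M \<and>
     bij_betw (\<lambda>(q, a). (out_letter M q a, next_state M q a))
       (states M \<times> alphabet M) (alphabet M \<times> states M)"

primrec mealy_act :: "('q, 'a) mealy \<Rightarrow> 'q \<Rightarrow> 'a list \<Rightarrow> 'a list" where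
  "mealy_act M q [] = []"
| "mealy_act M q (a # w) = out_letter M q a # mealy_act M (next_state M q a) w"

definition mealy_hom ::
    "('q, 'a) mealy \<Rightarrow> ('q \<times> bool) list \<Rightarrow> 'a list \<Rightarrow> 'a list" where
  "mealy_hom M = free_hom (BijGroup (lists (alphabet M)))
     (\<lambda>q. restrict (mealy_act M q) (lists (alphabet M)))"

definition mealy_group :: "('q, 'a) mealy \<Rightarrow> ('q \<times> bool) list set monoid" where
  "mealy_group M = free_group (states M) Mod
     kernel (free_group (states M)) (BijGroup (lists (alphabet M))) (mealy_hom M)"

text \<open>Alphabets and state sets are finite, so up to renaming they are sets of natural numbers.\<close>

definition bireversible_group :: "('a, 'b) monoid_scheme \<Rightarrow> bool" where
  "bireversible_group H \<longleftrightarrow>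
     (\<exists>M :: (nat, nat) mealy. bireversible_mealy M \<and> H \<cong> mealy_group M)"


section \<open>Basic properties\<close>

subsection \<open>The largest normalised subgroup\<close>

lemma subgroup_aut_group:
  "subgroup (carrier (aut_group X)) (BijGroup (pverts X))"
proof -
  interpret B: group "BijGroup (pverts X)" by (rule group_BijGroup)
  let ?V = "pverts X"
  show ?thesis
  proof (rule B.subgroupI)
    show "carrier (aut_group X) \<subseteq> carrier (BijGroup ?V)"
      by (auto simp: aut_group_def BijGroup_def)
    have "(\<lambda>x\<in>?V. x) \<in> carrier (aut_group X)"
      by (auto simp: aut_group_def id_Bij)
    then show "carrier (aut_group X) \<noteq> {}" by blast
  next
    fix f assume f: "f \<in> carrier (aut_group X)"
    then have fB: "f \<in> Bij ?V" by (simp add: aut_group_def)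
    have i: "inv\<^bsub>BijGroup ?V\<^esub> f = (\<lambda>x\<in>?V. inv_into ?V f x)"
      using fB by (rule inv_BijGroup)
    have "(inv_into ?V f u, inv_into ?V f v) \<in> parcs X \<longleftrightarrow> (u, v) \<in> parcs X"
      if "u \<in> ?V" "v \<in> ?V" for u v
    proof -
      have "inv_into ?V f u \<in> ?V" "inv_into ?V f v \<in> ?V"
        using Bij_inv_into_mem[OF fB] that by auto
      then have "(f (inv_into ?V f u), f (inv_into ?V f v)) \<in> parcs X \<longleftrightarrow>
          (inv_into ?V f u, inv_into ?V f v) \<in> parcs X"
        using f by (simp add: aut_group_def)
      moreover have "f (inv_into ?V f u) = u" "f (inv_into ?V f v) = v"
        using fB that by (auto simp: Bij_def bij_betw_inv_into_right)
      ultimately show ?thesis by simp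
    qed
    then show "inv\<^bsub>BijGroup ?V\<^esub> f \<in> carrier (aut_group X)"
      using restrict_inv_into_Bij[OF fB] by (auto simp: i aut_group_def)
  next
    fix f g assume f: "f \<in> carrier (aut_group X)" and g: "g \<in> carrier (aut_group X)"
    then have B: "f \<in> Bij ?V" "g \<in> Bij ?V" by (auto simp: aut_group_def)
    have "g u \<in> ?V" if "u \<in> ?V" for u using B(2) that Bij_imp_funcset by blast
    then show "f \<otimes>\<^bsub>BijGroup ?V\<^esub> g \<in> carrier (aut_group X)"
      using f g B compose_Bij[OF B] by (auto simp: aut_group_def BijGroup_def compose_def)
  qed
qed

lemma group_aut_group: "group (aut_group X)"
  using group.subgroup_imp_group[OF group_BijGroup subgroup_aut_group, of X]
  by (simp add: aut_group_def)

lemma left_mult_group_hom: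
  assumes "group G" and "S \<subseteq> carrier G"
  shows "group_hom G (aut_group (cayley_graph G S)) (left_mult G)"
proof -
  interpret G: group G by fact
  have B: "left_mult G g \<in> Bij (carrier G)" if g: "g \<in> carrier G" for g
  proof -
    have "bij_betw (left_mult G g) (carrier G) (carrier G)"
      by (rule bij_betw_byWitness[where f' = "left_mult G (inv\<^bsub>G\<^esub> g)"])
         (auto simp: left_mult_def g G.m_assoc[symmetric])
    then show ?thesis by (auto simp: Bij_def left_mult_def)
  qed
  have arcs: "(left_mult G g u, left_mult G g v) \<in> parcs (cayley_graph G S) \<longleftrightarrow>
      (u, v) \<in> parcs (cayley_graph G S)"
    if g: "g \<in> carrier G" and u: "u \<in> carrier G" and v: "v \<in> carrier G" for g u v
  proof -
    have "g \<otimes>\<^bsub>G\<^esub> v = g \<otimes>\<^bsub>G\<^esub> u \<otimes>\<^bsub>G\<^esub> s \<longleftrightarrow> v = u \<otimes>\<^bsub>G\<^esub> s"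
      if "s \<in> S \<union> m_inv G ` S" for s
    proof -
      have "s \<in> carrier G" using that assms(2) by auto
      then show ?thesis using g u v by (simp add: G.m_assoc)
    qed
    then show ?thesis using g u v
      by (simp add: cayley_graph_def left_mult_def) blast
  qed
  have "left_mult G \<in> hom G (aut_group (cayley_graph G S))"
  proof (rule homI)
    fix g assume "g \<in> carrier G"
    then show "left_mult G g \<in> carrier (aut_group (cayley_graph G S))"
      using B arcs by (auto simp: aut_group_def cayley_graph_def)
  next
    fix g h assume "g \<in> carrier G" "h \<in> carrier G"
    then show "left_mult G (g \<otimes>\<^bsub>G\<^esub> h) =
        left_mult G g \<otimes>\<^bsub>aut_group (cayley_graph G S)\<^esub> left_mult G h"
      using B[of g] B[of h]
      by (auto simp: aut_group_def cayley_graph_def BijGroup_def compose_def left_mult_def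
            G.m_assoc intro!: ext)
  qed
  then show ?thesis
    by (simp add: group_hom_def group_hom_axioms_def assms(1) group_aut_group)
qed

lemma left_mult_inj: "group G \<Longrightarrow> inj_on (left_mult G) (carrier G)"
  by (rule inj_onI) (metis group.is_monoid left_mult_def monoid.one_closed monoid.r_one
      restrict_apply')

lemma mem_normalizer_iff:
  assumes "H \<subseteq> carrier K"
  shows "k \<in> normalizer K H \<longleftrightarrow> k \<in> carrier K \<and> k <#\<^bsub>K\<^esub> H #>\<^bsub>K\<^esub> inv\<^bsub>K\<^esub> k = H"
  using assms by (auto simp: normalizer_def stabilizer_def)

lemma conj_set: "k <#\<^bsub>K\<^esub> H #>\<^bsub>K\<^esub> inv\<^bsub>K\<^esub> k = (\<lambda>x. k \<otimes>\<^bsub>K\<^esub> x \<otimes>\<^bsub>K\<^esub> inv\<^bsub>K\<^esub> k) ` H"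
  by (auto simp: l_coset_def r_coset_def)

lemma conj_group_hom:
  assumes "group K" and k: "k \<in> carrier K"
  shows "group_hom K K (\<lambda>x. k \<otimes>\<^bsub>K\<^esub> x \<otimes>\<^bsub>K\<^esub> inv\<^bsub>K\<^esub> k)"
proof -
  interpret group K by fact
  show ?thesis
  proof (unfold_locales, rule homI)
    fix x y assume xy: "x \<in> carrier K" "y \<in> carrier K"
    have "k \<otimes>\<^bsub>K\<^esub> x \<otimes>\<^bsub>K\<^esub> inv\<^bsub>K\<^esub> k \<otimes>\<^bsub>K\<^esub> (k \<otimes>\<^bsub>K\<^esub> y \<otimes>\<^bsub>K\<^esub> inv\<^bsub>K\<^esub> k) =
        k \<otimes>\<^bsub>K\<^esub> x \<otimes>\<^bsub>K\<^esub> (inv\<^bsub>K\<^esub> k \<otimes>\<^bsub>K\<^esub> k) \<otimes>\<^bsub>K\<^esub> y \<otimes>\<^bsub>K\<^esub> inv\<^bsub>K\<^esub> k"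
      using k xy by (simp only: m_assoc m_closed inv_closed)
    then show "k \<otimes>\<^bsub>K\<^esub> (x \<otimes>\<^bsub>K\<^esub> y) \<otimes>\<^bsub>K\<^esub> inv\<^bsub>K\<^esub> k =
        k \<otimes>\<^bsub>K\<^esub> x \<otimes>\<^bsub>K\<^esub> inv\<^bsub>K\<^esub> k \<otimes>\<^bsub>K\<^esub> (k \<otimes>\<^bsub>K\<^esub> y \<otimes>\<^bsub>K\<^esub> inv\<^bsub>K\<^esub> k)"
      using k xy by (simp add: m_assoc)
  qed (use k in auto)
qed

theorem D_subgroup_greatest:
  assumes "group G" and S: "S \<subseteq> carrier G"
  shows "comm_normalised G S (D_subgroup G S)"
    and "comm_normalised G S D \<Longrightarrow> D \<subseteq> D_subgroup G S"
proof -
  let ?A = "aut_group (cayley_graph G S)" and ?L = "left_mult G"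
  interpret L: group_hom G ?A ?L using assms by (rule left_mult_group_hom)
  let ?U = "\<Union>{D. comm_normalised G S D}"
  let ?D = "generate G ?U"
  have U: "?U \<subseteq> carrier G"
    by (auto simp: comm_normalised_def dest: subgroup.subset)
  have sub: "subgroup ?D G" using U by (rule L.G.generate_is_subgroup)
  have img: "?L ` ?D = generate ?A (?L ` ?U)"
    using L.generate_img[OF U] by simp
  have LU: "?L ` ?U \<subseteq> carrier ?A" using U L.hom_closed by blast
  have "c \<in> normalizer ?A (?L ` ?D)" if c: "c \<in> cayley_comm G S" for c
  proof -
    have cA: "c \<in> carrier ?A" using c by (simp add: cayley_comm_def commensurator_def)
    let ?c = "\<lambda>x. c \<otimes>\<^bsub>?A\<^esub> x \<otimes>\<^bsub>?A\<^esub> inv\<^bsub>?A\<^esub> c"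
    interpret c: group_hom ?A ?A ?c by (rule conj_group_hom) (use cA in auto)
    have "?c ` ?L ` D = ?L ` D" if "comm_normalised G S D" for D
    proof -
      have "?L ` D \<subseteq> carrier ?A" using LU that by blast
      moreover have "c \<in> normalizer ?A (?L ` D)"
        using that c by (auto simp: comm_normalised_def)
      ultimately show ?thesis by (simp add: mem_normalizer_iff conj_set)
    qed
    then have "?c ` ?L ` ?U = ?L ` ?U" unfolding image_Union by (auto simp: image_image)
    then have "?c ` ?L ` ?D = ?L ` ?D" using c.generate_img[OF LU] img by simp
    moreover have "?L ` ?D \<subseteq> carrier ?A"
      using L.hom_closed L.G.generate_incl[OF U] by blast
    ultimately show ?thesis using cA by (simp add: mem_normalizer_iff conj_set)
  qed
  then have P: "comm_normalised G S ?D"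
    using sub by (auto simp: comm_normalised_def)
  have le: "D \<subseteq> ?D" if "comm_normalised G S D" for D
    using that by (auto intro: generate.incl)
  have "D_subgroup G S = ?D"
    unfolding D_subgroup_def by (rule Greatest_equality) (use P le in auto)
  then show "comm_normalised G S (D_subgroup G S)"
    and "comm_normalised G S D \<Longrightarrow> D \<subseteq> D_subgroup G S"
    using P le by auto
qed

theorem D_subgroup_normal:
  assumes "group G" and S: "S \<subseteq> carrier G"
  shows "D_subgroup G S \<lhd> G"
proof -
  let ?A = "aut_group (cayley_graph G S)" and ?L = "left_mult G" and ?D = "D_subgroup G S"
  interpret L: group_hom G ?A ?L using assms by (rule left_mult_group_hom)
  let ?LG = "?L ` carrier G"
  have sub: "subgroup ?LG ?A" by (rule L.img_is_subgroup)
  interpret LG: group "?A\<lparr>carrier := ?LG\<rparr>" by (rule L.H.subgroup_imp_group[OF sub])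
  have "rcosets\<^bsub>?A\<lparr>carrier := ?LG\<rparr>\<^esub> ?LG = {?LG}"
  proof -
    have "?LG #>\<^bsub>?A\<lparr>carrier := ?LG\<rparr>\<^esub> x = ?LG" if "x \<in> ?LG" for x
      using LG.coset_join2[OF _ LG.subgroup_self, of x] that by simp
    moreover have "?LG \<noteq> {}" by blast
    ultimately show ?thesis unfolding RCOSETS_def by simp
  qed
  then have fin: "finite_index ?A ?LG ?LG" by (simp add: finite_index_def)
  have D: "subgroup ?D G" "cayley_comm G S \<subseteq> normalizer ?A (?L ` ?D)"
    using D_subgroup_greatest(1)[OF assms] by (auto simp: comm_normalised_def)
  have sD: "?D \<subseteq> carrier G" by (rule subgroup.subset[OF D(1)])
  have conj: "?L g <#\<^bsub>?A\<^esub> ?L ` X #>\<^bsub>?A\<^esub> inv\<^bsub>?A\<^esub> ?L g = ?L ` (\<lambda>x. g \<otimes>\<^bsub>G\<^esub> x \<otimes>\<^bsub>G\<^esub> inv\<^bsub>G\<^esub> g) ` X"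
    if "g \<in> carrier G" "X \<subseteq> carrier G" for g X
    unfolding conj_set image_image using that by (intro image_cong) (auto simp: subset_iff)
  show ?thesis
  proof (rule L.G.normal_invI[OF D(1)])
    fix g d assume g: "g \<in> carrier G" and d: "d \<in> ?D"
    have "(\<lambda>x. g \<otimes>\<^bsub>G\<^esub> x \<otimes>\<^bsub>G\<^esub> inv\<^bsub>G\<^esub> g) ` carrier G = carrier G"
    proof
      show "carrier G \<subseteq> (\<lambda>x. g \<otimes>\<^bsub>G\<^esub> x \<otimes>\<^bsub>G\<^esub> inv\<^bsub>G\<^esub> g) ` carrier G"
      proof
        fix x assume x: "x \<in> carrier G"
        have "g \<otimes>\<^bsub>G\<^esub> (inv\<^bsub>G\<^esub> g \<otimes>\<^bsub>G\<^esub> x) = x"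
          using g x by (simp add: L.G.m_assoc[symmetric])
        then have "x = g \<otimes>\<^bsub>G\<^esub> (inv\<^bsub>G\<^esub> g \<otimes>\<^bsub>G\<^esub> x \<otimes>\<^bsub>G\<^esub> g) \<otimes>\<^bsub>G\<^esub> inv\<^bsub>G\<^esub> g"
          using g x by (simp add: L.G.m_assoc)
        then show "x \<in> (\<lambda>x. g \<otimes>\<^bsub>G\<^esub> x \<otimes>\<^bsub>G\<^esub> inv\<^bsub>G\<^esub> g) ` carrier G"
          by (rule image_eqI) (use g x in simp)
      qed
    qed (use g in auto)
    then have "?L g \<in> cayley_comm G S"
      using conj[OF g subset_refl] g fin
      by (simp add: cayley_comm_def commensurator_def Let_def)
    then have "?L g \<in> normalizer ?A (?L ` ?D)" using D(2) by blast
    moreover have "?L ` ?D \<subseteq> carrier ?A" using sD L.hom_closed by blast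
    ultimately have "?L ` (\<lambda>x. g \<otimes>\<^bsub>G\<^esub> x \<otimes>\<^bsub>G\<^esub> inv\<^bsub>G\<^esub> g) ` ?D = ?L ` ?D"
      using conj[OF g sD] by (simp add: mem_normalizer_iff)
    moreover have "(\<lambda>x. g \<otimes>\<^bsub>G\<^esub> x \<otimes>\<^bsub>G\<^esub> inv\<^bsub>G\<^esub> g) ` ?D \<subseteq> carrier G"
      using g sD by (auto simp: subset_iff)
    ultimately have "(\<lambda>x. g \<otimes>\<^bsub>G\<^esub> x \<otimes>\<^bsub>G\<^esub> inv\<^bsub>G\<^esub> g) ` ?D = ?D"
      using inj_on_image_eq_iff[OF left_mult_inj[OF assms(1)] _ sD] by simp
    then show "g \<otimes>\<^bsub>G\<^esub> d \<otimes>\<^bsub>G\<^esub> inv\<^bsub>G\<^esub> g \<in> ?D" using d by blast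
  qed
qed


subsection \<open>The free group and the group generated by an automaton\<close>

lemma inv_letter_inv_letter [simp]: "inv_letter (inv_letter x) = x"
  by (simp add: inv_letter_def)

lemma reduced_Nil [simp]: "reduced []"
  by (simp add: reduced_def)

lemma reduced_Cons: "reduced (x # w) \<longleftrightarrow> reduced w \<and> (w = [] \<or> hd w \<noteq> inv_letter x)"
  by (cases w) (auto simp: reduced_def)

lemma reduced_cancel_cons: "reduced w \<Longrightarrow> reduced (cancel_cons x w)"
  by (cases w) (auto simp: cancel_cons_def reduced_Cons)

lemma reduced_mult: "reduced w \<Longrightarrow> reduced (foldr cancel_cons v w)"
  by (induction v) (auto intro: reduced_cancel_cons)

lemma cancel_cons_inv:
  assumes "reduced w"
  shows "cancel_cons x (cancel_cons (inv_letter x) w) = w"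
  using assms by (cases w) (auto simp: cancel_cons_def reduced_Cons)

lemma foldr_cancel_cons:
  assumes "reduced w"
  shows "foldr cancel_cons (cancel_cons x v) w = cancel_cons x (foldr cancel_cons v w)"
proof (cases v)
  case (Cons y v')
  then show ?thesis
    using cancel_cons_inv[OF reduced_mult[OF assms], of x v']
    by (auto simp: cancel_cons_def)
qed (simp add: cancel_cons_def)

lemma reduced_mult_Nil: "reduced v \<Longrightarrow> foldr cancel_cons v [] = v"
  by (induction v) (auto simp: cancel_cons_def reduced_Cons)

lemma foldr_cancel_inverse:
  assumes "reduced w"
  shows "foldr cancel_cons (rev (map inv_letter v)) (foldr cancel_cons v w) = w"
proof (induction v)
  case (Cons x v)
  have "reduced (foldr cancel_cons v w)" using assms by (rule reduced_mult)
  then have "cancel_cons (inv_letter x) (cancel_cons x (foldr cancel_cons v w)) =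
      foldr cancel_cons v w"
    using cancel_cons_inv[of _ "inv_letter x"] by simp
  then show ?case using Cons by simp
qed (use assms in simp)

lemma reduced_inverse: "reduced (rev (map inv_letter w)) \<longleftrightarrow> reduced w"
proof -
  have "inv_letter x = y \<longleftrightarrow> x = inv_letter y" for x y :: "'a \<times> bool"
    using inv_letter_inv_letter by metis
  then show ?thesis
    by (simp add: reduced_def successively_rev successively_map eq_commute)
qed

lemma lists_cancel_cons: "x \<in> X \<Longrightarrow> w \<in> lists X \<Longrightarrow> cancel_cons x w \<in> lists X"
  by (cases w) (auto simp: cancel_cons_def)

lemma lists_mult:
  assumes "v \<in> lists X" "w \<in> lists X"
  shows "foldr cancel_cons v w \<in> lists X"
  using assms(1) by induction (use assms(2) lists_cancel_cons in \<open>simp_all del: in_lists_conv_set\<close>)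

theorem group_free_group: "group (free_group Q)"
proof (rule groupI)
  fix u v w :: "('a \<times> bool) list"
  assume "w \<in> carrier (free_group Q)"
  then have w: "reduced w" by (simp add: free_group_def)
  show "u \<otimes>\<^bsub>free_group Q\<^esub> v \<otimes>\<^bsub>free_group Q\<^esub> w =
      u \<otimes>\<^bsub>free_group Q\<^esub> (v \<otimes>\<^bsub>free_group Q\<^esub> w)"
    by (induction u) (simp_all add: free_group_def foldr_cancel_cons[OF w])
next
  fix w assume "w \<in> carrier (free_group Q)"
  then have w: "reduced w" "w \<in> lists (Q \<times> UNIV)" by (auto simp: free_group_def)
  have "rev (map inv_letter w) \<in> lists (Q \<times> UNIV)"
    using w(2) by (fastforce simp: inv_letter_def)
  then show "\<exists>v\<in>carrier (free_group Q). v \<otimes>\<^bsub>free_group Q\<^esub> w = \<one>\<^bsub>free_group Q\<^esub>"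
    using w reduced_mult_Nil[OF w(1)] foldr_cancel_inverse[OF reduced_Nil, of w]
    by (intro bexI[of _ "rev (map inv_letter w)"])
       (simp_all add: free_group_def reduced_inverse del: in_lists_conv_set)
next
  fix v w assume "v \<in> carrier (free_group Q)" "w \<in> carrier (free_group Q)"
  then show "v \<otimes>\<^bsub>free_group Q\<^esub> w \<in> carrier (free_group Q)"
    by (simp add: free_group_def reduced_mult lists_mult del: in_lists_conv_set)
qed (simp_all add: free_group_def)

context
  fixes K :: "('a, 'b) monoid_scheme" and \<phi> :: "'q \<Rightarrow> 'a" and Q :: "'q set"
  assumes K: "group K" and \<phi>: "\<phi> \<in> Q \<rightarrow> carrier K"
begin

interpretation K: group K by (rule K)

lemma free_hom_closed: "w \<in> lists (Q \<times> UNIV) \<Longrightarrow> free_hom K \<phi> w \<in> carrier K"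
proof (induction w)
  case (Cons x w)
  then have "\<phi> (fst x) \<in> carrier K" using \<phi> by auto
  with Cons show ?case by (cases x) (simp add: free_hom_def)
qed (simp add: free_hom_def)

lemma free_hom_cancel_cons:
  assumes "q \<in> Q" "w \<in> lists (Q \<times> UNIV)"
  shows "free_hom K \<phi> (cancel_cons (q, b) w) =
    (if b then \<phi> q else inv\<^bsub>K\<^esub> (\<phi> q)) \<otimes>\<^bsub>K\<^esub> free_hom K \<phi> w"
proof (cases "w \<noteq> [] \<and> hd w = inv_letter (q, b)")
  case True
  then obtain w' where w: "w = (q, \<not> b) # w'"
    by (cases w) (auto simp: inv_letter_def)
  have "free_hom K \<phi> w' \<in> carrier K" using assms w free_hom_closed by simp
  moreover have "\<phi> q \<in> carrier K" using \<phi> assms by auto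
  ultimately show ?thesis
    using w by (auto simp: cancel_cons_def inv_letter_def free_hom_def K.m_assoc[symmetric])
next
  case False
  then have "cancel_cons (q, b) w = (q, b) # w" by (auto simp: cancel_cons_def)
  then show ?thesis by (simp add: free_hom_def)
qed

lemma free_hom_mult:
  assumes "v \<in> lists (Q \<times> UNIV)" "w \<in> lists (Q \<times> UNIV)"
  shows "free_hom K \<phi> (foldr cancel_cons v w) = free_hom K \<phi> v \<otimes>\<^bsub>K\<^esub> free_hom K \<phi> w"
  using assms(1)
proof (induction v)
  case Nil
  then show ?case using free_hom_closed[OF assms(2)] by (simp add: free_hom_def)
next
  case (Cons x v)
  obtain q b where x: "x = (q, b)" by (cases x)
  have q: "q \<in> Q" and v: "v \<in> lists (Q \<times> UNIV)" using Cons x by auto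
  have "\<phi> q \<in> carrier K" using \<phi> q by auto
  then have "(if b then \<phi> q else inv\<^bsub>K\<^esub> (\<phi> q)) \<in> carrier K" by simp
  moreover have "free_hom K \<phi> (x # v) =
      (if b then \<phi> q else inv\<^bsub>K\<^esub> (\<phi> q)) \<otimes>\<^bsub>K\<^esub> free_hom K \<phi> v"
    by (simp add: free_hom_def x)
  ultimately show ?case
    using free_hom_cancel_cons[OF q lists_mult[OF v assms(2)], of b] Cons.IH v x
      free_hom_closed[OF v] free_hom_closed[OF assms(2)]
    by (simp add: K.m_assoc del: in_lists_conv_set)
qed

theorem free_group_hom: "group_hom (free_group Q) K (free_hom K \<phi>)"
proof -
  have "free_hom K \<phi> \<in> hom (free_group Q) K"
    by (rule homI)
       (simp_all add: free_group_def free_hom_closed free_hom_mult del: in_lists_conv_set)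
  then show ?thesis
    by (simp add: group_hom_def group_hom_axioms_def K group_free_group)
qed

lemma free_hom_image: "free_hom K \<phi> ` carrier (free_group Q) = generate K (\<phi> ` Q)"
proof -
  interpret f: group_hom "free_group Q" K "free_hom K \<phi>" by (rule free_group_hom)
  show ?thesis
  proof
    have "free_hom K \<phi> w \<in> generate K (\<phi> ` Q)" if "w \<in> lists (Q \<times> UNIV)" for w
      using that
    proof (induction w)
      case Nil
      then show ?case by (simp add: free_hom_def generate.one)
    next
      case (Cons x w)
      then have "(if snd x then \<phi> (fst x) else inv\<^bsub>K\<^esub> (\<phi> (fst x))) \<in> generate K (\<phi> ` Q)"
        by (auto intro: generate.incl generate.inv)
      moreover have "free_hom K \<phi> w \<in> generate K (\<phi> ` Q)" using Cons by simp
      ultimately have "(if snd x then \<phi> (fst x) else inv\<^bsub>K\<^esub> (\<phi> (fst x))) \<otimes>\<^bsub>K\<^esub> free_hom K \<phi> w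
          \<in> generate K (\<phi> ` Q)"
        by (rule generate.eng)
      then show ?case by (simp add: free_hom_def case_prod_beta)
    qed
    then show "free_hom K \<phi> ` carrier (free_group Q) \<subseteq> generate K (\<phi> ` Q)"
      by (auto simp: free_group_def)
    have "\<phi> q \<in> free_hom K \<phi> ` carrier (free_group Q)" if "q \<in> Q" for q
    proof (rule image_eqI)
      show "[(q, True)] \<in> carrier (free_group Q)"
        using that by (simp add: free_group_def reduced_Cons)
      show "\<phi> q = free_hom K \<phi> [(q, True)]"
        using K.r_one[OF funcset_mem[OF \<phi> that]] by (simp add: free_hom_def)
    qed
    then show "generate K (\<phi> ` Q) \<subseteq> free_hom K \<phi> ` carrier (free_group Q)"
      by (intro K.generate_subgroup_incl f.img_is_subgroup) auto
  qed
qed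

end

lemma mealy_act_closed:
  assumes "mealy_automaton M" "q \<in> states M" "w \<in> lists (alphabet M)"
  shows "mealy_act M q w \<in> lists (alphabet M)"
  using assms(3,2)
proof (induction w arbitrary: q)
  case (Cons a w)
  then show ?case using assms(1)
    by (auto simp: mealy_automaton_def Pi_iff)
qed simp

lemma mealy_act_Bij:
  assumes M: "mealy_automaton M" "invertible_mealy M" and q: "q \<in> states M"
  shows "restrict (mealy_act M q) (lists (alphabet M)) \<in> Bij (lists (alphabet M))"
proof -
  let ?A = "alphabet M"
  have inj: "v = w" if "v \<in> lists ?A" "w \<in> lists ?A" "q \<in> states M"
    "mealy_act M q v = mealy_act M q w" for v w q
    using that
  proof (induction v arbitrary: w q)
    case Nil
    then show ?case by (cases w) auto
  next
    case (Cons a v)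
    then obtain b w' where w: "w = b # w'" by (cases w) auto
    have "a = b" using Cons w M(2)
      by (auto simp: invertible_mealy_def bij_betw_def dest: inj_onD)
    moreover have "next_state M q a \<in> states M"
      using Cons M(1) by (auto simp: mealy_automaton_def Pi_iff)
    ultimately show ?case using Cons w by auto
  qed
  have surj: "\<exists>v\<in>lists ?A. mealy_act M q v = w" if "w \<in> lists ?A" "q \<in> states M" for w q
    using that
  proof (induction w arbitrary: q)
    case (Cons b w)
    then have "b \<in> out_letter M q ` ?A"
      using M(2) by (auto simp: invertible_mealy_def bij_betw_def)
    then obtain a where a: "a \<in> ?A" "out_letter M q a = b" by auto
    have "next_state M q a \<in> states M"
      using Cons a M(1) by (auto simp: mealy_automaton_def Pi_iff)
    then obtain v where "v \<in> lists ?A" "mealy_act M (next_state M q a) v = w"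
      using Cons by metis
    with a show ?case by (intro bexI[of _ "a # v"]) auto
  qed (auto intro!: bexI[of _ "[]"])
  have "bij_betw (mealy_act M q) (lists ?A) (lists ?A)"
    unfolding bij_betw_def
  proof
    show "inj_on (mealy_act M q) (lists ?A)" using inj q by (auto intro!: inj_onI)
    show "mealy_act M q ` lists ?A = lists ?A"
      using mealy_act_closed[OF M(1) q] surj[OF _ q] by (fastforce simp del: in_lists_conv_set)
  qed
  then show ?thesis by (simp add: Bij_def)
qed

theorem mealy_group_iso:
  assumes M: "mealy_automaton M" "invertible_mealy M"
  shows "mealy_group M \<cong> (BijGroup (lists (alphabet M)))
    \<lparr>carrier := generate (BijGroup (lists (alphabet M)))
       ((\<lambda>q. restrict (mealy_act M q) (lists (alphabet M))) ` states M)\<rparr>"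
proof -
  let ?B = "BijGroup (lists (alphabet M))"
  let ?\<phi> = "\<lambda>q. restrict (mealy_act M q) (lists (alphabet M))"
  have \<phi>: "?\<phi> \<in> states M \<rightarrow> carrier ?B"
    using mealy_act_Bij[OF M] by (auto simp: BijGroup_def)
  interpret f: group_hom "free_group (states M)" ?B "mealy_hom M"
    unfolding mealy_hom_def by (rule free_group_hom[OF group_BijGroup \<phi>])
  let ?I = "?B\<lparr>carrier := mealy_hom M ` carrier (free_group (states M))\<rparr>"
  have I: "group ?I"
    by (rule f.H.subgroup_imp_group[OF f.img_is_subgroup])
  have "mealy_hom M \<in> hom (free_group (states M)) ?I"
    by (rule homI) auto
  then interpret g: group_hom "free_group (states M)" ?I "mealy_hom M"
    by (simp add: group_hom_def group_hom_axioms_def I)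
  have "kernel (free_group (states M)) ?I (mealy_hom M) =
      kernel (free_group (states M)) ?B (mealy_hom M)"
    by (simp add: kernel_def)
  then have "mealy_group M \<cong> ?I"
    using g.FactGroup_iso by (simp add: mealy_group_def)
  then show ?thesis
    using free_hom_image[OF group_BijGroup \<phi>] by (simp add: mealy_hom_def)
qed

end

theory Submission
  imports Defs
begin

text \<open>Write \<open>L g\<close> for left multiplication by \<open>g\<close>.  For an automorphism \<open>a\<close> of the Cayley graph, moving
  the vertex \<open>a(g)\<close> back to \<open>1\<close> gives the section \<open>a|g = (L a(g))\<inverse> a (L g)\<close> of \<open>a\<close> at \<open>g\<close>, which
  fixes \<open>1\<close>.  The sections of \<open>a\<close> represent the cosets \<open>G a (L g)\<close> of \<open>G\<close> by elements of the vertex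
  stabiliser, so an element of the commensurator has only finitely many of them (\<open>finite_sections\<close>).

  Take a finite subset \<open>F\<close> of the commensurator and let \<open>Q\<close> be the finite set of all sections of its
  elements.  The rule \<open>a (L g) = (L a(g)) (a|g)\<close> for moving a group element past an automorphism makes
  \<open>Q\<close> and \<open>G\<close> act on each other, with \<open>Q\<close> permuting the neighbours of \<open>1\<close>.  This is an automaton
  whose letters are the elements of \<open>Q\<close> and whose states are the neighbours of \<open>1\<close>.  It is
  bireversible (\<open>dual_bireversible\<close>), and the group that it generates is \<open>G\<close> modulo the subgroup \<open>N\<close>
  of elements acting trivially on all words over \<open>Q\<close> (\<open>bireversible_quotient\<close>).

  For \<open>a\<close> in \<open>Q\<close> and \<open>n\<close> in \<open>N\<close> we have \<open>a|n = a\<close> and \<open>a(n)\<close> lies in \<open>N\<close> again; in other words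
  \<open>a (L n) a\<inverse> = L a(n)\<close>.  In fact \<open>N\<close> is the largest subgroup of \<open>G\<close> with this property.  So \<open>N\<close>
  contains every subgroup of \<open>G\<close> normalised by the commensurator (\<open>D_subset_fixator\<close>), while the
  intersection of the subgroups \<open>N\<close> over all \<open>F\<close> is itself normalised by the commensurator and hence
  equal to the largest such subgroup (\<open>fixators_meet_in_D\<close>).  This gives an \<open>F\<close> whose \<open>N\<close> avoids
  a prescribed \<open>g\<close>, and enlarging \<open>F\<close> can only make \<open>N\<close> smaller.

  It remains to make the quotient infinite.  Put into \<open>F\<close> finitely many elements of the
  commensurator that fix \<open>1\<close> and generate an infinite group, together with their inverses.  Each \<open>p\<close>
  in the group generated by them satisfies \<open>p(n x) = p(n) p(x)\<close> for \<open>n\<close> in \<open>N\<close>.  If \<open>N\<close> had finite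
  index, such a \<open>p\<close> would be determined by its values on finitely many vertices, and as it preserves
  distances from \<open>1\<close> only finitely many \<open>p\<close> would exist (\<open>finite_automorphisms\<close>).\<close>

section \<open>Bireversible automata over arbitrary types\<close>

text \<open>Alphabet and state set are finite, so that injectivity is all that has to be checked.\<close>

lemma bireversible_mealyI:
  assumes M: "mealy_automaton M"
    and out: "\<And>q. q \<in> states M \<Longrightarrow> inj_on (out_letter M q) (alphabet M)"
    and nxt: "\<And>a. a \<in> alphabet M \<Longrightarrow> inj_on (\<lambda>q. next_state M q a) (states M)"
    and both: "inj_on (\<lambda>(q, a). (out_letter M q a, next_state M q a)) (states M \<times> alphabet M)"
  shows "bireversible_mealy M"
proof -
  have fin: "finite (alphabet M)" "finite (states M)"
    and cl: "\<And>q a. q \<in> states M \<Longrightarrow> a \<in> alphabet M \<Longrightarrow> out_letter M q a \<in> alphabet M"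
      "\<And>q a. q \<in> states M \<Longrightarrow> a \<in> alphabet M \<Longrightarrow> next_state M q a \<in> states M"
    using M by (auto simp: mealy_automaton_def)
  let ?f = "\<lambda>(q, a). (out_letter M q a, next_state M q a)"
  have "?f ` (states M \<times> alphabet M) \<subseteq> alphabet M \<times> states M"
    using cl by auto
  moreover have "card (?f ` (states M \<times> alphabet M)) = card (alphabet M \<times> states M)"
    using card_image[OF both] by (simp add: card_cartesian_product mult.commute)
  ultimately have "?f ` (states M \<times> alphabet M) = alphabet M \<times> states M"
    using fin by (intro card_subset_eq) auto
  moreover have "out_letter M q ` alphabet M = alphabet M" if "q \<in> states M" for q
    using cl(1)[OF that] by (intro endo_inj_surj fin out that image_subsetI)
  moreover have "(\<lambda>q. next_state M q a) ` states M = states M" if "a \<in> alphabet M" for a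
    using cl(2)[OF _ that] by (intro endo_inj_surj fin nxt that image_subsetI)
  ultimately show ?thesis
    using assms by (simp add: bireversible_mealy_def invertible_mealy_def reversible_mealy_def
        bij_betw_def)
qed

text \<open>Renaming the points of \<open>X\<close> along a bijection turns permutations of \<open>X\<close> into
  permutations of \<open>Y\<close>.\<close>

lemma Bij_conjugate_hom:
  assumes \<theta>: "bij_betw \<theta> X Y"
  defines "h \<equiv> \<lambda>u. \<lambda>y\<in>Y. \<theta> (u (inv_into X \<theta> y))"
  shows "group_hom (BijGroup X) (BijGroup Y) h" and "inj_on h (carrier (BijGroup X))"
proof -
  have inv: "bij_betw (inv_into X \<theta>) Y X" using \<theta> by (rule bij_betw_inv_into)
  have ap: "h u (\<theta> x) = \<theta> (u x)" if "x \<in> X" for u x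
    using that \<theta> by (auto simp: h_def bij_betw_def)
  have Y: "Y = \<theta> ` X" using \<theta> by (simp add: bij_betw_def)
  have uX: "u x \<in> X" if "u \<in> Bij X" "x \<in> X" for u x
    using that Bij_imp_funcset by blast
  have hB: "h u \<in> Bij Y" if "u \<in> Bij X" for u
  proof -
    have "bij_betw (\<theta> \<circ> u \<circ> inv_into X \<theta>) Y Y"
      using that \<theta> inv by (auto simp: Bij_def intro!: bij_betw_trans)
    then show ?thesis by (simp add: Bij_def h_def comp_def cong: bij_betw_cong)
  qed
  show "group_hom (BijGroup X) (BijGroup Y) h"
  proof (intro group_hom.intro group_hom_axioms.intro group_BijGroup homI)
    fix u v assume uv: "u \<in> carrier (BijGroup X)" "v \<in> carrier (BijGroup X)"
    then have B: "u \<in> Bij X" "v \<in> Bij X" by (auto simp: BijGroup_def)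
    show "h (u \<otimes>\<^bsub>BijGroup X\<^esub> v) = h u \<otimes>\<^bsub>BijGroup Y\<^esub> h v"
    proof (rule extensionalityI[of _ Y])
      fix y assume "y \<in> Y"
      then obtain x where x: "x \<in> X" "y = \<theta> x" using Y by auto
      then show "h (u \<otimes>\<^bsub>BijGroup X\<^esub> v) y = (h u \<otimes>\<^bsub>BijGroup Y\<^esub> h v) y"
        using B hB uX Y by (simp add: BijGroup_def compose_def ap)
    qed (use B hB in \<open>auto simp: BijGroup_def compose_def h_def\<close>)
  qed (use hB in \<open>simp add: BijGroup_def\<close>)
  show "inj_on h (carrier (BijGroup X))"
  proof (rule inj_onI)
    fix u v assume "u \<in> carrier (BijGroup X)" "v \<in> carrier (BijGroup X)" and eq: "h u = h v"
    then have B: "u \<in> Bij X" "v \<in> Bij X" by (auto simp: BijGroup_def)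
    show "u = v"
    proof (rule extensionalityI[of _ X])
      fix x assume x: "x \<in> X"
      then have "\<theta> (u x) = \<theta> (v x)" using ap[OF x] eq by metis
      then show "u x = v x"
        using \<theta> uX B x by (auto simp: bij_betw_def dest: inj_onD)
    qed (use B in \<open>auto simp: Bij_def\<close>)
  qed
qed

lemma group_mealy_group:
  assumes M: "mealy_automaton M" "invertible_mealy M"
  shows "group (mealy_group M)"
proof -
  let ?B = "BijGroup (lists (alphabet M))"
  have "(\<lambda>q. restrict (mealy_act M q) (lists (alphabet M))) \<in> states M \<rightarrow> carrier ?B"
    using mealy_act_Bij[OF M] by (auto simp: BijGroup_def)
  then interpret f: group_hom "free_group (states M)" ?B "mealy_hom M"
    unfolding mealy_hom_def by (rule free_group_hom[OF group_BijGroup])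
  show ?thesis
    unfolding mealy_group_def by (rule normal.factorgroup_is_group[OF f.normal_kernel])
qed

text \<open>Renaming letters and states by natural numbers conjugates the generated group by the
  induced bijection of words.  This frees later constructions from encoding: their letters can be
  automorphisms and their states group elements.\<close>

theorem bireversible_group_mealy_group:
  fixes M :: "('q, 'c) mealy"
  assumes M: "bireversible_mealy M"
  shows "bireversible_group (mealy_group M)"
proof -
  let ?A = "alphabet M" and ?Q = "states M"
  have aut: "mealy_automaton M" and invb: "invertible_mealy M" and rev: "reversible_mealy M"
    and both: "inj_on (\<lambda>(q, a). (out_letter M q a, next_state M q a)) (?Q \<times> ?A)"
    using M by (auto simp: bireversible_mealy_def bij_betw_def)
  have cl: "out_letter M q a \<in> ?A" "next_state M q a \<in> ?Q" if "q \<in> ?Q" "a \<in> ?A" for q a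
    using aut that by (auto simp: mealy_automaton_def)
  obtain e :: "'c \<Rightarrow> nat" where e: "inj_on e ?A"
    using finite_imp_inj_to_nat_seg[of ?A] aut by (auto simp: mealy_automaton_def)
  obtain f :: "'q \<Rightarrow> nat" where f: "inj_on f ?Q"
    using finite_imp_inj_to_nat_seg[of ?Q] aut by (auto simp: mealy_automaton_def)
  define M' where "M' = \<lparr>alphabet = e ` ?A, states = f ` ?Q,
    out_letter = \<lambda>q a. e (out_letter M (inv_into ?Q f q) (inv_into ?A e a)),
    next_state = \<lambda>q a. f (next_state M (inv_into ?Q f q) (inv_into ?A e a))\<rparr>"
  have [simp]: "alphabet M' = e ` ?A" "states M' = f ` ?Q" by (simp_all add: M'_def)
  have [simp]: "out_letter M' (f q) (e a) = e (out_letter M q a)"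
    "next_state M' (f q) (e a) = f (next_state M q a)" if "q \<in> ?Q" "a \<in> ?A" for q a
    using that e f by (simp_all add: M'_def)
  have e_iff: "e a = e b \<longleftrightarrow> a = b" if "a \<in> ?A" "b \<in> ?A" for a b
    using e that by (auto dest: inj_onD)
  have f_iff: "f a = f b \<longleftrightarrow> a = b" if "a \<in> ?Q" "b \<in> ?Q" for a b
    using f that by (auto dest: inj_onD)
  have M': "bireversible_mealy M'"
  proof (rule bireversible_mealyI)
    show "mealy_automaton M'"
      using aut cl by (auto simp: mealy_automaton_def)
  next
    fix q assume "q \<in> states M'"
    then obtain p where p: "p \<in> ?Q" "q = f p" by auto
    then have "inj_on (out_letter M p) ?A"
      using invb by (simp add: invertible_mealy_def bij_betw_def)
    then show "inj_on (out_letter M' q) (alphabet M')"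
      using p by (auto simp: inj_on_def e_iff cl)
  next
    fix a assume "a \<in> alphabet M'"
    then obtain b where b: "b \<in> ?A" "a = e b" by auto
    then have "inj_on (\<lambda>q. next_state M q b) ?Q"
      using rev by (simp add: reversible_mealy_def bij_betw_def)
    then show "inj_on (\<lambda>q. next_state M' q a) (states M')"
      using b by (auto simp: inj_on_def f_iff cl)
  next
    have "f q = f p \<and> e a = e b" if "q \<in> ?Q" "p \<in> ?Q" "a \<in> ?A" "b \<in> ?A"
      "e (out_letter M q a) = e (out_letter M p b)"
      "f (next_state M q a) = f (next_state M p b)" for q p a b
      using inj_onD[OF both, of "(q, a)" "(p, b)"] that
      by (simp add: e_iff[OF cl(1) cl(1)] f_iff[OF cl(2) cl(2)])
    note inj = this
    show "inj_on (\<lambda>(q, a). (out_letter M' q a, next_state M' q a)) (states M' \<times> alphabet M')"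
    proof (rule inj_onI, clarsimp)
      fix q a p b
      assume "q \<in> ?Q" "a \<in> ?A" "p \<in> ?Q" "b \<in> ?A"
        "e (out_letter M q a) = e (out_letter M p b)"
        "f (next_state M q a) = f (next_state M p b)"
      then show "f q = f p \<and> e a = e b" by (intro inj)
    qed
  qed
  let ?B = "BijGroup (lists ?A)" and ?B' = "BijGroup (lists (alphabet M'))"
  let ?g = "\<lambda>q. restrict (mealy_act M q) (lists ?A)"
  let ?g' = "\<lambda>q. restrict (mealy_act M' q) (lists (alphabet M'))"
  have \<theta>: "bij_betw (map e) (lists ?A) (lists (alphabet M'))"
    using e by (auto simp: bij_betw_def lists_image intro: inj_on_mapI inj_on_subset)
  define h where "h = (\<lambda>u. \<lambda>y\<in>lists (alphabet M'). map e (u (inv_into (lists ?A) (map e) y)))"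
  interpret h: group_hom ?B ?B' h
    unfolding h_def by (rule Bij_conjugate_hom(1)[OF \<theta>])
  have h_inj: "inj_on h (carrier ?B)"
    unfolding h_def by (rule Bij_conjugate_hom(2)[OF \<theta>])
  have act: "mealy_act M' (f q) (map e w) = map e (mealy_act M q w)"
    if "q \<in> ?Q" "w \<in> lists ?A" for q w
    using that(2,1) by (induction w arbitrary: q) (auto simp: cl)
  have "h (?g q) = ?g' (f q)" if "q \<in> ?Q" for q
  proof (rule extensionalityI[of _ "lists (alphabet M')"])
    fix y assume y: "y \<in> lists (alphabet M')"
    then obtain w where w: "w \<in> lists ?A" "y = map e w"
      using bij_betw_imp_surj_on[OF \<theta>] by blast
    then have "inv_into (lists ?A) (map e) y = w"
      using bij_betw_inv_into_left[OF \<theta>] by simp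
    then show "h (?g q) y = ?g' (f q) y"
      using y w act[OF that w(1)] by (simp add: h_def)
  qed (auto simp: h_def)
  then have gens: "h ` ?g ` ?Q = ?g' ` states M'" by (simp add: image_image)
  have g: "?g ` ?Q \<subseteq> carrier ?B"
    using mealy_act_Bij[OF aut invb] by (auto simp: BijGroup_def)
  let ?U = "generate ?B (?g ` ?Q)"
  have U: "subgroup ?U ?B" by (rule h.G.generate_is_subgroup[OF g])
  have img: "h ` ?U = generate ?B' (?g' ` states M')"
    using h.generate_img[OF g] gens by simp
  have "h \<in> iso (?B\<lparr>carrier := ?U\<rparr>) (?B'\<lparr>carrier := h ` ?U\<rparr>)"
    using subgroup.subset[OF U] inj_on_subset[OF h_inj subgroup.subset[OF U]]
    by (auto simp: iso_def hom_def bij_betw_def subset_iff)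
  then have "?B\<lparr>carrier := ?U\<rparr> \<cong> ?B'\<lparr>carrier := h ` ?U\<rparr>"
    by (auto simp: is_iso_def)
  moreover have "mealy_group M \<cong> ?B\<lparr>carrier := ?U\<rparr>"
    by (rule mealy_group_iso[OF aut invb])
  moreover have "?B'\<lparr>carrier := h ` ?U\<rparr> \<cong> mealy_group M'"
  proof -
    have i: "mealy_group M' \<cong> ?B'\<lparr>carrier := h ` ?U\<rparr>"
      unfolding img using M' by (intro mealy_group_iso) (auto simp: bireversible_mealy_def)
    have "group (mealy_group M')"
      using M' by (intro group_mealy_group) (auto simp: bireversible_mealy_def)
    then show ?thesis using i by (rule group.iso_sym)
  qed
  ultimately have "mealy_group M \<cong> mealy_group M'"
    by (meson iso_trans)
  with M' show ?thesis unfolding bireversible_group_def by blast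
qed

section \<open>Groups acting on words through an automaton\<close>

text \<open>The states of an automaton are often a generating set of a group \<open>G\<close> such that its output
  and transition functions make sense for every element of \<open>G\<close>, not only for the states.  If the
  output is an action and the transitions form a cocycle over it, then \<open>G\<close> acts on words, and the
  automaton generates the image of \<open>G\<close> under this action.\<close>

locale automaton_action = group G for G (structure) +
  fixes M :: "('a, 'c) mealy"
  assumes out_closed: "g \<in> carrier G \<Longrightarrow> a \<in> alphabet M \<Longrightarrow> out_letter M g a \<in> alphabet M"
    and next_closed: "g \<in> carrier G \<Longrightarrow> a \<in> alphabet M \<Longrightarrow> next_state M g a \<in> carrier G"
    and out_one: "a \<in> alphabet M \<Longrightarrow> out_letter M \<one> a = a"
    and out_mult: "g \<in> carrier G \<Longrightarrow> h \<in> carrier G \<Longrightarrow> a \<in> alphabet M \<Longrightarrow>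
      out_letter M (g \<otimes> h) a = out_letter M g (out_letter M h a)"
    and next_mult: "g \<in> carrier G \<Longrightarrow> h \<in> carrier G \<Longrightarrow> a \<in> alphabet M \<Longrightarrow>
      next_state M (g \<otimes> h) a = next_state M g (out_letter M h a) \<otimes> next_state M h a"
begin

definition act :: "'a \<Rightarrow> 'c list \<Rightarrow> 'c list" where
  "act g = restrict (mealy_act M g) (lists (alphabet M))"

definition trivial :: "'a set" where
  "trivial = {g \<in> carrier G. \<forall>w\<in>lists (alphabet M). mealy_act M g w = w}"

lemma next_one: "a \<in> alphabet M \<Longrightarrow> next_state M \<one> a = \<one>"
  using next_mult[of \<one> \<one> a] next_closed[of \<one> a] out_one[of a] by simp

lemma mealy_act_lists:
  "w \<in> lists (alphabet M) \<Longrightarrow> g \<in> carrier G \<Longrightarrow> mealy_act M g w \<in> lists (alphabet M)"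
  by (induction w arbitrary: g) (auto simp: out_closed next_closed)

lemma mealy_act_one: "w \<in> lists (alphabet M) \<Longrightarrow> mealy_act M \<one> w = w"
  by (induction w) (auto simp: out_one next_one)

lemma mealy_act_mult:
  "w \<in> lists (alphabet M) \<Longrightarrow> g \<in> carrier G \<Longrightarrow> h \<in> carrier G \<Longrightarrow>
    mealy_act M (g \<otimes> h) w = mealy_act M g (mealy_act M h w)"
  by (induction w arbitrary: g h)
     (auto simp: out_mult next_mult out_closed next_closed simp del: in_lists_conv_set)

lemma act_hom: "group_hom G (BijGroup (lists (alphabet M))) act"
proof (intro group_hom.intro group_hom_axioms.intro group_BijGroup homI is_group)
  have B: "act g \<in> Bij (lists (alphabet M))" if g: "g \<in> carrier G" for g
  proof -
    have "bij_betw (mealy_act M g) (lists (alphabet M)) (lists (alphabet M))"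
      by (rule bij_betw_byWitness[where f' = "mealy_act M (inv g)"])
         (simp_all add: g mealy_act_lists mealy_act_one mealy_act_mult[symmetric] image_subset_iff
           del: in_lists_conv_set)
    then show ?thesis by (simp add: act_def Bij_def cong: bij_betw_cong)
  qed
  fix g assume g: "g \<in> carrier G"
  then show "act g \<in> carrier (BijGroup (lists (alphabet M)))"
    using B by (simp add: BijGroup_def)
  fix h assume h: "h \<in> carrier G"
  show "act (g \<otimes> h) = act g \<otimes>\<^bsub>BijGroup (lists (alphabet M))\<^esub> act h"
  proof (rule extensionalityI[of _ "lists (alphabet M)"])
    fix w assume "w \<in> lists (alphabet M)"
    then show "act (g \<otimes> h) w = (act g \<otimes>\<^bsub>BijGroup (lists (alphabet M))\<^esub> act h) w"
      using B g h mealy_act_lists[of w h]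
      by (simp add: BijGroup_def compose_def mealy_act_mult act_def del: in_lists_conv_set)
  qed (use B g h in \<open>auto simp: BijGroup_def compose_def act_def\<close>)
qed

lemma trivial_eq_kernel: "trivial = kernel G (BijGroup (lists (alphabet M))) act"
proof -
  have "act g = (\<lambda>w\<in>lists (alphabet M). w) \<longleftrightarrow> (\<forall>w\<in>lists (alphabet M). mealy_act M g w = w)" for g
    unfolding act_def by (metis restrict_apply' restrict_ext)
  then show ?thesis by (simp add: trivial_def kernel_def BijGroup_def)
qed

lemma trivial_normal: "trivial \<lhd> G"
  unfolding trivial_eq_kernel by (rule group_hom.normal_kernel[OF act_hom])

theorem bireversible_quotient:
  assumes M: "bireversible_mealy M"
    and states: "states M \<subseteq> carrier G" "generate G (states M) = carrier G"
  shows "bireversible_group (G Mod trivial)"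
proof -
  let ?B = "BijGroup (lists (alphabet M))"
  interpret act: group_hom G ?B act by (rule act_hom)
  let ?I = "?B\<lparr>carrier := act ` carrier G\<rparr>"
  have I: "group ?I" by (rule act.H.subgroup_imp_group[OF act.img_is_subgroup])
  have "act \<in> hom G ?I" by (rule homI) auto
  then interpret g: group_hom G ?I act
    by (simp add: group_hom_def group_hom_axioms_def I)
  have "kernel G ?I act = trivial" by (simp add: kernel_def trivial_eq_kernel)
  then have "G Mod trivial \<cong> ?I" using g.FactGroup_iso by simp
  moreover have "?I \<cong> mealy_group M"
  proof -
    have "act ` carrier G = generate ?B (act ` states M)"
      using act.generate_img[OF states(1)] states(2) by simp
    moreover have "act = (\<lambda>q. restrict (mealy_act M q) (lists (alphabet M)))"
      by (simp add: act_def fun_eq_iff)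
    moreover have aut: "mealy_automaton M" "invertible_mealy M"
      using M by (auto simp: bireversible_mealy_def)
    ultimately have "mealy_group M \<cong> ?I" using mealy_group_iso[OF aut] by simp
    then show ?thesis by (rule group.iso_sym[OF group_mealy_group[OF aut]])
  qed
  moreover obtain M' :: "(nat, nat) mealy"
    where "bireversible_mealy M'" "mealy_group M \<cong> mealy_group M'"
    using bireversible_group_mealy_group[OF M] by (auto simp: bireversible_group_def)
  ultimately show ?thesis
    unfolding bireversible_group_def by (meson iso_trans)
qed

end

section \<open>Commensurators\<close>

text \<open>Used to bound the number of sections by a number of cosets.\<close>

lemma finite_image_coarser:
  assumes "finite (r ` A)"
    and "\<And>x y. x \<in> A \<Longrightarrow> y \<in> A \<Longrightarrow> r x = r y \<Longrightarrow> k x = k y"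
  shows "finite (k ` A)"
proof -
  have "k ` A = (\<lambda>c. k (inv_into A r c)) ` (r ` A)"
    unfolding image_image using assms(2)
    by (intro image_cong refl) (metis f_inv_into_f imageI inv_into_into)
  then show ?thesis using assms(1) by simp
qed

lemma finite_index_conjugate:
  assumes "group K" and k: "k \<in> carrier K" and H: "H \<subseteq> carrier K" and J: "J \<subseteq> carrier K"
    and fin: "finite_index K H J"
  shows "finite_index K (k <#\<^bsub>K\<^esub> H #>\<^bsub>K\<^esub> inv\<^bsub>K\<^esub> k) (k <#\<^bsub>K\<^esub> J #>\<^bsub>K\<^esub> inv\<^bsub>K\<^esub> k)"
proof -
  let ?c = "\<lambda>x. k \<otimes>\<^bsub>K\<^esub> x \<otimes>\<^bsub>K\<^esub> inv\<^bsub>K\<^esub> k"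
  interpret c: group_hom K K ?c by (rule conj_group_hom[OF assms(1) k])
  have img: "(?c ` J) #>\<^bsub>K\<^esub> ?c x = ?c ` (J #>\<^bsub>K\<^esub> x)" if "x \<in> H" for x
  proof -
    have "?c j \<otimes>\<^bsub>K\<^esub> ?c x = ?c (j \<otimes>\<^bsub>K\<^esub> x)" if "j \<in> J" for j
      using c.hom_mult[OF subsetD[OF J that] subsetD[OF H \<open>x \<in> H\<close>]] by simp
    then show ?thesis unfolding r_coset_def by auto
  qed
  have r: "rcosets\<^bsub>K\<lparr>carrier := H\<rparr>\<^esub> J = (\<lambda>x. J #>\<^bsub>K\<^esub> x) ` H" for H J
    by (auto simp: RCOSETS_def r_coset_def)
  have "(\<lambda>x. (?c ` J) #>\<^bsub>K\<^esub> x) ` ?c ` H = image ?c ` (\<lambda>x. J #>\<^bsub>K\<^esub> x) ` H"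
    unfolding image_image using img by (intro image_cong) auto
  then show ?thesis using fin unfolding finite_index_def r conj_set by simp
qed

text \<open>Conjugation by the inverse of \<open>k\<close> exchanges the two index conditions.\<close>

lemma commensurator_inv:
  assumes "group K" and H: "H \<subseteq> carrier K" and k: "k \<in> commensurator K H"
  shows "inv\<^bsub>K\<^esub> k \<in> commensurator K H"
proof -
  interpret K: group K by fact
  let ?c = "\<lambda>k X. k <#\<^bsub>K\<^esub> X #>\<^bsub>K\<^esub> inv\<^bsub>K\<^esub> k"
  have kK: "k \<in> carrier K"
    and fin: "finite_index K H (H \<inter> ?c k H)" "finite_index K (?c k H) (H \<inter> ?c k H)"
    using k by (auto simp: commensurator_def Let_def)
  let ?i = "inv\<^bsub>K\<^esub> k"
  have sub: "?c k H \<subseteq> carrier K" using H kK by (auto simp: conj_set)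
  have canc: "?i \<otimes>\<^bsub>K\<^esub> (k \<otimes>\<^bsub>K\<^esub> x \<otimes>\<^bsub>K\<^esub> ?i) \<otimes>\<^bsub>K\<^esub> k = x" if "x \<in> H" for x
  proof -
    have "x \<in> carrier K" using that H by auto
    then show ?thesis using kK by (simp add: K.m_assoc) (simp add: K.m_assoc[symmetric])
  qed
  have ci: "?c ?i X = (\<lambda>x. ?i \<otimes>\<^bsub>K\<^esub> x \<otimes>\<^bsub>K\<^esub> k) ` X" for X
    unfolding conj_set using kK by simp
  have undo: "?c ?i (?c k H) = H"
    unfolding ci unfolding conj_set image_image using canc by simp
  have inj: "inj_on (\<lambda>x. ?i \<otimes>\<^bsub>K\<^esub> x \<otimes>\<^bsub>K\<^esub> k) (carrier K)"
    using kK by (intro inj_onI) simp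
  have meet: "?c ?i (H \<inter> ?c k H) = H \<inter> ?c ?i H"
    using inj_on_image_Int[OF inj H sub] undo unfolding ci by (simp add: Int_commute)
  have i: "?i \<in> carrier K" using kK by simp
  have "finite_index K (?c ?i H) (H \<inter> ?c ?i H)"
    using finite_index_conjugate[OF assms(1) i H _ fin(1)] H meet by auto
  moreover have "finite_index K H (H \<inter> ?c ?i H)"
    using finite_index_conjugate[OF assms(1) i sub _ fin(2)] H meet undo by auto
  ultimately show ?thesis using i by (simp add: commensurator_def Let_def)
qed

section \<open>Sections of automorphisms of a Cayley graph\<close>

context group
begin

lemma mult_inv_cancel [simp]:
  "x \<in> carrier G \<Longrightarrow> y \<in> carrier G \<Longrightarrow> x \<otimes> (inv x \<otimes> y) = y"
  "x \<in> carrier G \<Longrightarrow> y \<in> carrier G \<Longrightarrow> inv x \<otimes> (x \<otimes> y) = y"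
  by (simp_all add: m_assoc[symmetric])

lemma inv_eq_iff: "x \<in> carrier G \<Longrightarrow> y \<in> carrier G \<Longrightarrow> inv x = inv y \<longleftrightarrow> x = y"
  by (metis inv_inv)

end

locale cayley = group G for G (structure) +
  fixes S :: "'a set"
  assumes S_closed: "S \<subseteq> carrier G" and S_finite: "finite S" and S_generates: "generate G S = carrier G"
begin

abbreviation K :: "('a \<Rightarrow> 'a) monoid" where "K \<equiv> aut_group (cayley_graph G S)"
abbreviation L :: "'a \<Rightarrow> 'a \<Rightarrow> 'a" where "L \<equiv> left_mult G"
abbreviation C :: "('a \<Rightarrow> 'a) set" where "C \<equiv> cayley_comm G S"

definition T :: "'a set" where "T = S \<union> m_inv G ` S"

sublocale L: group_hom G K L
  by (rule left_mult_group_hom[OF is_group S_closed])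

lemma T_closed: "T \<subseteq> carrier G" and T_finite: "finite T"
  and T_inv: "t \<in> T \<Longrightarrow> inv t \<in> T"
  using S_closed S_finite by (auto simp: T_def subset_iff)

lemma T_generates: "generate G T = carrier G"
  using mono_generate[of S T] S_generates generate_incl[OF T_closed] by (auto simp: T_def)

lemma aut_Bij: "a \<in> carrier K \<Longrightarrow> a \<in> Bij (carrier G)"
  by (simp add: aut_group_def cayley_graph_def)

lemma aut_closed: "a \<in> carrier K \<Longrightarrow> x \<in> carrier G \<Longrightarrow> a x \<in> carrier G"
  using aut_Bij Bij_imp_funcset by blast

lemma aut_inj:
  "a \<in> carrier K \<Longrightarrow> x \<in> carrier G \<Longrightarrow> y \<in> carrier G \<Longrightarrow> a x = a y \<longleftrightarrow> x = y"
  using aut_Bij[of a] by (auto simp: Bij_def bij_betw_def dest: inj_onD)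

lemma aut_mult:
  assumes "a \<in> carrier K" "b \<in> carrier K" "x \<in> carrier G"
  shows "(a \<otimes>\<^bsub>K\<^esub> b) x = a (b x)"
  using aut_Bij[OF assms(1)] aut_Bij[OF assms(2)] assms(3)
  by (simp add: aut_group_def BijGroup_def cayley_graph_def compose_def)

lemma aut_one: "x \<in> carrier G \<Longrightarrow> \<one>\<^bsub>K\<^esub> x = x"
  by (simp add: aut_group_def BijGroup_def cayley_graph_def)

declare aut_closed [simp]

lemma aut_inv [simp]:
  assumes "a \<in> carrier K" "x \<in> carrier G"
  shows "a ((inv\<^bsub>K\<^esub> a) x) = x" "(inv\<^bsub>K\<^esub> a) (a x) = x"
  using aut_mult[of a "inv\<^bsub>K\<^esub> a" x] aut_mult[of "inv\<^bsub>K\<^esub> a" a x] assms by (simp_all add: aut_one)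

lemma aut_eqI:
  assumes "a \<in> carrier K" "b \<in> carrier K" "\<And>x. x \<in> carrier G \<Longrightarrow> a x = b x"
  shows "a = b"
  by (rule extensionalityI[of _ "carrier G"]) (use assms aut_Bij in \<open>auto simp: Bij_def\<close>)

lemma left_mult_apply [simp]: "x \<in> carrier G \<Longrightarrow> L g x = g \<otimes> x"
  by (simp add: left_mult_def)

text \<open>Automorphisms need not preserve the labels of edges; the label of the image of an edge is
  merely some element of \<open>T\<close>.\<close>

lemma aut_edge:
  assumes a: "a \<in> carrier K" and g: "g \<in> carrier G" and t: "t \<in> T"
  shows "inv (a g) \<otimes> a (g \<otimes> t) \<in> T"
proof -
  have tG: "t \<in> carrier G" using t T_closed by blast
  have "(g, g \<otimes> t) \<in> parcs (cayley_graph G S)"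
    using g t by (auto simp: cayley_graph_def T_def)
  then have "(a g, a (g \<otimes> t)) \<in> parcs (cayley_graph G S)"
    using a g tG by (simp add: aut_group_def cayley_graph_def del: aut_closed)
  then obtain s where s: "s \<in> T" "a (g \<otimes> t) = a g \<otimes> s"
    by (auto simp: cayley_graph_def T_def)
  then have "s \<in> carrier G" using T_closed by blast
  then have "inv (a g) \<otimes> a (g \<otimes> t) = s"
    using a g s(2) by (simp add: m_assoc[symmetric])
  then show ?thesis using s(1) by simp
qed

text \<open>The representative of the coset of \<open>a\<close> times left multiplication by \<open>g\<close>, modulo left
  multiplications, that fixes the vertex \<open>\<one>\<close>.\<close>

definition section_at :: "('a \<Rightarrow> 'a) \<Rightarrow> 'a \<Rightarrow> 'a \<Rightarrow> 'a" where
  "section_at a g = inv\<^bsub>K\<^esub> (L (a g)) \<otimes>\<^bsub>K\<^esub> a \<otimes>\<^bsub>K\<^esub> L g"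

lemma section_closed [simp]:
  "a \<in> carrier K \<Longrightarrow> g \<in> carrier G \<Longrightarrow> section_at a g \<in> carrier K"
  by (simp add: section_at_def)

lemma section_apply:
  "a \<in> carrier K \<Longrightarrow> g \<in> carrier G \<Longrightarrow> x \<in> carrier G \<Longrightarrow>
    section_at a g x = inv (a g) \<otimes> a (g \<otimes> x)"
  by (simp add: section_at_def aut_mult L.hom_inv[symmetric] del: L.hom_inv)

lemma section_fixes_one: "a \<in> carrier K \<Longrightarrow> g \<in> carrier G \<Longrightarrow> section_at a g \<one> = \<one>"
  by (simp add: section_apply)

lemma section_section:
  assumes "a \<in> carrier K" "g \<in> carrier G" "h \<in> carrier G"
  shows "section_at (section_at a g) h = section_at a (g \<otimes> h)"
proof (rule aut_eqI)
  fix x assume x: "x \<in> carrier G"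
  show "section_at (section_at a g) h x = section_at a (g \<otimes> h) x"
    using assms x by (simp add: section_apply inv_mult_group m_assoc)
qed (use assms in auto)

lemma section_one:
  "a \<in> carrier K \<Longrightarrow> a \<one> = \<one> \<Longrightarrow> section_at a \<one> = a"
  by (rule aut_eqI) (simp_all add: section_apply)

lemma C_closed: "c \<in> C \<Longrightarrow> c \<in> carrier K"
  by (simp add: cayley_comm_def commensurator_def)

lemma C_inv: "c \<in> C \<Longrightarrow> inv\<^bsub>K\<^esub> c \<in> C"
  unfolding cayley_comm_def by (rule commensurator_inv) auto

text \<open>The index condition bounds the number of right cosets of \<open>H \<inter> c H c\<inverse>\<close> in
  \<open>c H c\<inverse>\<close>, where \<open>H\<close> is the image of \<open>G\<close>.  If \<open>c g c\<inverse>\<close> and \<open>c h c\<inverse>\<close>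
  lie in the same one, then \<open>c g = u c h\<close> for some \<open>u\<close> in \<open>G\<close>, and this forces
  the sections of \<open>c\<close> at \<open>g\<close> and \<open>h\<close> to agree.\<close>

lemma finite_sections:
  assumes c: "c \<in> C"
  shows "finite (section_at c ` carrier G)"
proof -
  have cK: "c \<in> carrier K" using c by (rule C_closed)
  let ?H = "L ` carrier G"
  let ?H' = "c <#\<^bsub>K\<^esub> ?H #>\<^bsub>K\<^esub> inv\<^bsub>K\<^esub> c"
  let ?k = "\<lambda>g. c \<otimes>\<^bsub>K\<^esub> L g \<otimes>\<^bsub>K\<^esub> inv\<^bsub>K\<^esub> c"
  let ?r = "\<lambda>g. (?H \<inter> ?H') #>\<^bsub>K\<^esub> ?k g"
  have kK: "?k g \<in> carrier K" if "g \<in> carrier G" for g using that cK by simp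
  have "?r g \<in> rcosets\<^bsub>K\<lparr>carrier := ?H'\<rparr>\<^esub> (?H \<inter> ?H')" if "g \<in> carrier G" for g
    using that unfolding RCOSETS_def conj_set by (auto simp: r_coset_def)
  then have "?r ` carrier G \<subseteq> rcosets\<^bsub>K\<lparr>carrier := ?H'\<rparr>\<^esub> (?H \<inter> ?H')" by blast
  moreover have "finite (rcosets\<^bsub>K\<lparr>carrier := ?H'\<rparr>\<^esub> (?H \<inter> ?H'))"
    using c by (simp add: cayley_comm_def commensurator_def finite_index_def Let_def)
  ultimately have fin: "finite (?r ` carrier G)" by (rule finite_subset)
  show ?thesis
  proof (rule finite_image_coarser[OF fin])
    fix g h assume g: "g \<in> carrier G" and h: "h \<in> carrier G" and eq: "?r g = ?r h"
    have "\<one>\<^bsub>K\<^esub> \<in> ?H" using L.hom_one by (metis image_eqI one_closed)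
    moreover have "\<one>\<^bsub>K\<^esub> = ?k \<one>" using cK by simp
    ultimately have one: "\<one>\<^bsub>K\<^esub> \<in> ?H \<inter> ?H'" unfolding conj_set by blast
    have sub: "?H \<inter> ?H' \<subseteq> carrier K" by auto
    have "\<one>\<^bsub>K\<^esub> \<otimes>\<^bsub>K\<^esub> ?k g \<in> ?r g" by (rule L.H.rcosI[OF one sub kK[OF g]])
    then have "?k g \<in> ?r h" using L.H.l_one[OF kK[OF g]] by (simp only: eq)
    then obtain u where u: "u \<in> carrier G" "?k g = L u \<otimes>\<^bsub>K\<^esub> ?k h"
      by (auto simp: r_coset_def)
    have "?k g (c x) = (L u \<otimes>\<^bsub>K\<^esub> ?k h) (c x)" if "x \<in> carrier G" for x
      using u(2) by simp
    then have cg: "c (g \<otimes> x) = u \<otimes> c (h \<otimes> x)" if "x \<in> carrier G" for x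
      using that cK g h u(1) by (simp add: aut_mult)
    show "section_at c g = section_at c h"
    proof (rule aut_eqI)
      fix x assume x: "x \<in> carrier G"
      show "section_at c g x = section_at c h x"
        using cg[of \<one>] cg[OF x] u(1) cK g h x
        by (simp add: section_apply inv_mult_group m_assoc)
    qed (use cK g h in auto)
  qed
qed

end

section \<open>The dual automaton and the elements acting trivially\<close>

context cayley
begin

text \<open>Sections give a right action of \<open>G\<close>, since the section at \<open>g h\<close> is the section at \<open>h\<close> of
  the section at \<open>g\<close>.  The inverses turn it into a left action, as words are acted on from
  the left.  The natural automaton of a set of automorphisms has states \<open>Q\<close> and letters \<open>T\<close>;
  here the two roles are exchanged, so that the generated group is a quotient of \<open>G\<close>.\<close>

definition dual :: "('a \<Rightarrow> 'a) set \<Rightarrow> ('a, 'a \<Rightarrow> 'a) mealy" where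
  "dual Q = \<lparr>alphabet = Q, states = T,
     out_letter = \<lambda>g a. section_at a (inv g), next_state = \<lambda>g a. inv (a (inv g))\<rparr>"

lemma dual_simps [simp]:
  "alphabet (dual Q) = Q" "states (dual Q) = T"
  "out_letter (dual Q) g a = section_at a (inv g)" "next_state (dual Q) g a = inv (a (inv g))"
  by (simp_all add: dual_def)

definition section_closed_set :: "('a \<Rightarrow> 'a) set \<Rightarrow> bool" where
  "section_closed_set Q \<longleftrightarrow> finite Q \<and> Q \<subseteq> carrier K \<and> (\<forall>a\<in>Q. a \<one> = \<one>) \<and>
     (\<forall>a\<in>Q. \<forall>g\<in>carrier G. section_at a g \<in> Q)"

lemma dual_action:
  assumes Q: "section_closed_set Q"
  shows "automaton_action G (dual Q)"
proof
  fix g h a assume g: "g \<in> carrier G" and h: "h \<in> carrier G" and "a \<in> alphabet (dual Q)"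
  then have a: "a \<in> carrier K" using Q by (auto simp: section_closed_set_def)
  show "out_letter (dual Q) (g \<otimes> h) a = out_letter (dual Q) g (out_letter (dual Q) h a)"
    using a g h by (simp add: section_section inv_mult_group)
  have "a (inv h \<otimes> inv g) = a (inv h) \<otimes> section_at a (inv h) (inv g)"
    using a g h by (simp add: section_apply)
  then show "next_state (dual Q) (g \<otimes> h) a =
      next_state (dual Q) g (out_letter (dual Q) h a) \<otimes> next_state (dual Q) h a"
    using a g h by (simp add: inv_mult_group)
qed (use Q in \<open>auto simp: section_closed_set_def section_one\<close>)

text \<open>The last of the injectivity conditions says that an automorphism \<open>a\<close> fixing \<open>\<one>\<close> and an element
  \<open>g\<close> can be recovered from \<open>a g\<close> and the section of \<open>a\<close> at \<open>g\<close>: these two determine the map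
  \<open>x \<mapsto> a (g x)\<close>, and \<open>g\<inverse>\<close> is the only point that it sends to \<open>\<one>\<close>.\<close>

lemma dual_bireversible:
  assumes Q: "section_closed_set Q"
  shows "bireversible_mealy (dual Q)"
proof (rule bireversible_mealyI)
  have QK: "a \<in> carrier K" "a \<one> = \<one>" if "a \<in> Q" for a
    using that Q by (auto simp: section_closed_set_def)
  have TG: "t \<in> carrier G" if "t \<in> T" for t using that T_closed by blast
  interpret act: automaton_action G "dual Q" by (rule dual_action[OF Q])
  have nxt_T: "inv (a (inv t)) \<in> T" if "a \<in> Q" "t \<in> T" for a t
    using aut_edge[OF QK(1)[OF that(1)] one_closed T_inv[OF that(2)]] QK[OF that(1)] TG[OF that(2)]
      T_inv by simp
  show "mealy_automaton (dual Q)"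
    using Q nxt_T TG T_finite by (auto simp: mealy_automaton_def section_closed_set_def)
  show "inj_on (out_letter (dual Q) q) (alphabet (dual Q))" if "q \<in> states (dual Q)" for q
  proof (rule inj_on_inverseI)
    fix a assume a: "a \<in> alphabet (dual Q)"
    show "out_letter (dual Q) (inv q) (out_letter (dual Q) q a) = a"
      using act.out_mult[of "inv q" q a] act.out_one[OF a] a that TG[of q] by simp
  qed
  show "inj_on (\<lambda>q. next_state (dual Q) q a) (states (dual Q))" if "a \<in> alphabet (dual Q)" for a
    using that QK[of a] TG by (intro inj_onI) (simp add: aut_inj inv_eq_iff)
  show "inj_on (\<lambda>(q, a). (out_letter (dual Q) q a, next_state (dual Q) q a))
      (states (dual Q) \<times> alphabet (dual Q))"
  proof (rule inj_onI, clarsimp)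
    fix s a t b
    assume s: "s \<in> T" and a: "a \<in> Q" and t: "t \<in> T" and b: "b \<in> Q"
      and sec: "section_at a (inv s) = section_at b (inv t)"
      and nxt: "inv (a (inv s)) = inv (b (inv t))"
    note st = TG[OF s] TG[OF t] and ab = QK[OF a] QK[OF b]
    have ab_s: "a (inv s) = b (inv t)" using nxt st ab by (simp add: inv_eq_iff)
    have ab_x: "a (inv s \<otimes> x) = b (inv t \<otimes> x)" if "x \<in> carrier G" for x
      using fun_cong[OF sec, of x] that st ab ab_s by (simp add: section_apply)
    have "b (inv t \<otimes> s) = b \<one>" using ab_x[of s] st ab by simp
    then have "inv t \<otimes> s = \<one>" using st aut_inj[OF ab(3)] by simp
    then have "s = t" using st inv_solve_left'[of \<one> t s] by simp
    moreover have "a x = b x" if "x \<in> carrier G" for x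
      using ab_x[of "s \<otimes> x"] st that \<open>s = t\<close> by (simp add: m_assoc[symmetric])
    ultimately show "s = t \<and> a = b" using aut_eqI ab by blast
  qed
qed

abbreviation fixator :: "('a \<Rightarrow> 'a) set \<Rightarrow> 'a set" where
  "fixator Q \<equiv> automaton_action.trivial G (dual Q)"

lemma fixator_iff:
  "section_closed_set Q \<Longrightarrow>
    g \<in> fixator Q \<longleftrightarrow> g \<in> carrier G \<and> (\<forall>w\<in>lists Q. mealy_act (dual Q) g w = w)"
  by (simp add: automaton_action.trivial_def[OF dual_action])

lemma fixator_normal: "section_closed_set Q \<Longrightarrow> fixator Q \<lhd> G"
  by (rule automaton_action.trivial_normal[OF dual_action])

lemma fixator_subgroup: "section_closed_set Q \<Longrightarrow> subgroup (fixator Q) G"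
  by (rule normal_imp_subgroup[OF fixator_normal])

lemma fixator_closed: "section_closed_set Q \<Longrightarrow> g \<in> fixator Q \<Longrightarrow> g \<in> carrier G"
  by (simp add: fixator_iff)

text \<open>The action of \<open>G\<close> on a word does not see the ambient set of letters.\<close>

lemma fixator_antimono:
  assumes "section_closed_set P" "section_closed_set Q" "P \<subseteq> Q"
  shows "fixator Q \<subseteq> fixator P"
proof -
  have "mealy_act (dual P) g w = mealy_act (dual Q) g w" for g w
    by (induction w arbitrary: g) simp_all
  moreover have "lists P \<subseteq> lists Q" using assms(3) by (rule lists_mono)
  ultimately show ?thesis using assms(1,2) by (auto simp: fixator_iff subset_iff)
qed

text \<open>Since \<open>g\<inverse>\<close> fixes the word \<open>a # w\<close> for every \<open>w\<close>, it fixes its first letter \<open>a\<close>, and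
  the state reached after reading \<open>a\<close>, which is the inverse of \<open>a g\<close>, fixes \<open>w\<close>.\<close>

lemma fixator_section:
  assumes Q: "section_closed_set Q" and g: "g \<in> fixator Q" and a: "a \<in> Q"
  shows "section_at a g = a" and "a g \<in> fixator Q"
proof -
  interpret N: subgroup "fixator Q" G by (rule fixator_subgroup[OF Q])
  have gG: "g \<in> carrier G" using fixator_closed[OF Q g] .
  have aK: "a \<in> carrier K" using Q a by (auto simp: section_closed_set_def)
  have act: "mealy_act (dual Q) (inv g) (a # w) = a # w" if "w \<in> lists Q" for w
  proof -
    have "inv g \<in> fixator Q" using g by (rule N.m_inv_closed)
    moreover have "a # w \<in> lists Q" using a that by simp
    ultimately show ?thesis using Q fixator_iff by blast
  qed
  show "section_at a g = a" using act[of "[]"] gG by simp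
  have "inv (a g) \<in> fixator Q"
    using act gG aK by (simp add: fixator_iff[OF Q] del: in_lists_conv_set)
  then have "inv (inv (a g)) \<in> fixator Q" by (rule N.m_inv_closed)
  then show "a g \<in> fixator Q" using gG aK by simp
qed

lemma fixator_mult:
  assumes Q: "section_closed_set Q" and g: "g \<in> fixator Q" and a: "a \<in> Q" and x: "x \<in> carrier G"
  shows "a (g \<otimes> x) = a g \<otimes> a x"
proof -
  have gG: "g \<in> carrier G" using fixator_closed[OF Q g] .
  have aK: "a \<in> carrier K" using Q a by (auto simp: section_closed_set_def)
  have "a x = inv (a g) \<otimes> a (g \<otimes> x)"
    using section_apply[OF aK gG x] fixator_section(1)[OF Q g a] by simp
  then show ?thesis using gG aK x by simp
qed

text \<open>By \<open>fixator_section\<close> the fixator satisfies the hypothesis on \<open>X\<close>, so it is the largest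
  subgroup that does.\<close>

lemma subset_fixatorI:
  assumes Q: "section_closed_set Q" and X: "subgroup X G"
    and step: "\<And>a x. a \<in> Q \<Longrightarrow> x \<in> X \<Longrightarrow> section_at a x = a \<and> a x \<in> X"
  shows "X \<subseteq> fixator Q"
proof
  interpret X: subgroup X G by (rule X)
  have "mealy_act (dual Q) g w = w" if "w \<in> lists Q" "g \<in> X" for w g
    using that
  proof (induction w arbitrary: g)
    case (Cons a w)
    then have "section_at a (inv g) = a \<and> a (inv g) \<in> X" by (intro step) auto
    with Cons show ?case by simp
  qed simp
  then show "g \<in> fixator Q" if "g \<in> X" for g
    using that X.mem_carrier by (simp add: fixator_iff[OF Q] del: in_lists_conv_set)
qed

definition sections :: "('a \<Rightarrow> 'a) set \<Rightarrow> ('a \<Rightarrow> 'a) set" where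
  "sections F = (\<Union>c\<in>F. section_at c ` carrier G)"

lemma sections_closed:
  assumes "finite F" "F \<subseteq> C"
  shows "section_closed_set (sections F)"
  unfolding section_closed_set_def
proof (intro conjI ballI)
  have K: "c \<in> carrier K" if "c \<in> F" for c using assms(2) C_closed that by blast
  show "finite (sections F)"
    unfolding sections_def using assms finite_sections by blast
  show "sections F \<subseteq> carrier K" using K by (auto simp: sections_def)
  fix a assume "a \<in> sections F"
  then obtain c g where c: "c \<in> F" "g \<in> carrier G" "a = section_at c g"
    by (auto simp: sections_def)
  show "a \<one> = \<one>" using K c by (simp add: section_fixes_one)
  fix h assume "h \<in> carrier G"
  then have "section_at a h = section_at c (g \<otimes> h)" "g \<otimes> h \<in> carrier G"
    using K c by (simp_all add: section_section)
  then show "section_at a h \<in> sections F" using c(1) by (auto simp: sections_def)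
qed

lemma sections_mono: "E \<subseteq> F \<Longrightarrow> sections E \<subseteq> sections F"
  by (auto simp: sections_def)

lemma section_in_sections: "c \<in> F \<Longrightarrow> g \<in> carrier G \<Longrightarrow> section_at c g \<in> sections F"
  by (auto simp: sections_def)

text \<open>Let \<open>D\<close> be the largest subgroup of \<open>G\<close> normalised by the commensurator.  If \<open>a\<close> is the
  section of \<open>c\<close> at \<open>g\<close>, then \<open>a\<close> is a product of \<open>c\<close> with elements of \<open>G\<close> and
  therefore normalises \<open>D\<close>.  As \<open>a\<close> fixes \<open>\<one>\<close>, the relation \<open>a d = d' a\<close> gives \<open>d' = a(d)\<close>, which
  says that the section of \<open>a\<close> at \<open>d\<close> is \<open>a\<close> itself.\<close>

lemma D_subset_fixator:
  assumes F: "finite F" "F \<subseteq> C"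
  shows "D_subgroup G S \<subseteq> fixator (sections F)"
proof (rule subset_fixatorI[OF sections_closed[OF F]])
  let ?D = "D_subgroup G S"
  have norm: "C \<subseteq> normalizer K (L ` ?D)"
    using D_subgroup_greatest(1)[OF is_group S_closed] by (simp add: comm_normalised_def)
  interpret D: normal ?D G by (rule D_subgroup_normal[OF is_group S_closed])
  show "subgroup ?D G" by (rule D.subgroup_axioms)
  fix a d assume "a \<in> sections F" and d: "d \<in> ?D"
  then obtain c g where c: "c \<in> F" and g: "g \<in> carrier G" and a: "a = section_at c g"
    by (auto simp: sections_def)
  have cC: "c \<in> C" using c F by blast
  then have cK: "c \<in> carrier K" by (rule C_closed)
  have dG: "d \<in> carrier G" using d by (rule D.mem_carrier)
  \<comment> \<open>the section at \<open>g\<close> sees \<open>d\<close> through its conjugate by \<open>g\<close>, since \<open>g d x = (g d g\<inverse>) g x\<close>\<close>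
  have gdg: "g \<otimes> d \<otimes> inv g \<in> ?D" using g d by (rule D.inv_op_closed2)
  have "(\<lambda>x. c \<otimes>\<^bsub>K\<^esub> x \<otimes>\<^bsub>K\<^esub> inv\<^bsub>K\<^esub> c) ` L ` ?D = L ` ?D"
  proof -
    have "L ` ?D \<subseteq> carrier K" using D.subset L.hom_closed by blast
    from subsetD[OF norm cC, unfolded mem_normalizer_iff[OF this] conj_set]
    show ?thesis by (rule conjunct2)
  qed
  then have "c \<otimes>\<^bsub>K\<^esub> L (g \<otimes> d \<otimes> inv g) \<otimes>\<^bsub>K\<^esub> inv\<^bsub>K\<^esub> c \<in> L ` ?D" using gdg by blast
  then obtain e where e: "e \<in> ?D" "c \<otimes>\<^bsub>K\<^esub> L (g \<otimes> d \<otimes> inv g) \<otimes>\<^bsub>K\<^esub> inv\<^bsub>K\<^esub> c = L e" by blast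
  have eG: "e \<in> carrier G" using e(1) by (rule D.mem_carrier)
  have ce: "c (g \<otimes> (d \<otimes> x)) = e \<otimes> c (g \<otimes> x)" if x: "x \<in> carrier G" for x
  proof -
    have "(c \<otimes>\<^bsub>K\<^esub> L (g \<otimes> d \<otimes> inv g) \<otimes>\<^bsub>K\<^esub> inv\<^bsub>K\<^esub> c) (c (g \<otimes> x)) = e \<otimes> c (g \<otimes> x)"
      using e(2) x g cK by simp
    then show ?thesis
      using x g dG cK by (simp add: aut_mult m_assoc del: L.hom_mult L.hom_inv)
  qed
  let ?d' = "inv (c g) \<otimes> e \<otimes> c g"
  have ax: "a (d \<otimes> x) = ?d' \<otimes> a x" if x: "x \<in> carrier G" for x
    using x g dG eG cK ce[OF x] by (simp add: a section_apply m_assoc)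
  have "a \<one> = \<one>" using cK g by (simp add: a section_fixes_one)
  then have ad: "a d = ?d'" using ax[of \<one>] dG eG g cK by simp
  have "?d' \<in> ?D" using D.inv_op_closed1[OF _ e(1), of "c g"] g cK by simp
  moreover have "section_at a d = a"
  proof (rule aut_eqI)
    fix x assume x: "x \<in> carrier G"
    show "section_at a d x = a x"
      using ax[OF x] x dG eG g cK by (simp add: section_apply a ad[unfolded a])
  qed (use a cK g dG in auto)
  ultimately show "section_at a d = a \<and> a d \<in> ?D" using ad by simp
qed

text \<open>An element \<open>c\<close> of the commensurator is the translation by \<open>c \<one>\<close> after its section \<open>a\<close> at
  \<open>\<one>\<close>.  The latter is a letter as soon as \<open>c \<in> F\<close>, so \<open>a\<close> preserves the intersection \<open>J\<close> of all
  fixators and acts on it as conjugation; translations normalise \<open>J\<close> because every fixator is normal.\<close>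

lemma fixators_meet_in_D:
  assumes g: "g \<in> carrier G" and all: "\<And>F. finite F \<Longrightarrow> F \<subseteq> C \<Longrightarrow> g \<in> fixator (sections F)"
  shows "g \<in> D_subgroup G S"
proof -
  define J where "J = {g \<in> carrier G. \<forall>F. finite F \<longrightarrow> F \<subseteq> C \<longrightarrow> g \<in> fixator (sections F)}"
  have J: "subgroup J G"
  proof (rule subgroupI)
    have "\<one> \<in> J"
      by (auto simp: J_def intro!: subgroup.one_closed fixator_subgroup sections_closed)
    then show "J \<noteq> {}" by blast
  qed (auto simp: J_def intro!: subgroup.m_closed subgroup.m_inv_closed fixator_subgroup sections_closed)
  have conj: "c \<otimes>\<^bsub>K\<^esub> L n \<otimes>\<^bsub>K\<^esub> inv\<^bsub>K\<^esub> c \<in> L ` J" if c: "c \<in> C" and n: "n \<in> J" for c n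
  proof
    have cK: "c \<in> carrier K" using c by (rule C_closed)
    have nG: "n \<in> carrier G" using n by (simp add: J_def)
    let ?a = "section_at c \<one>"
    \<comment> \<open>this is the element \<open>c n c\<inverse>\<close>, described without reference to any \<open>F\<close>\<close>
    let ?u = "c \<one> \<otimes> ?a n \<otimes> inv (c \<one>)"
    have aK: "?a \<in> carrier K" using cK by simp
    have uG: "?u \<in> carrier G" using cK aK nG by simp
    have in_N: "?a n \<in> fixator (sections F)" if F: "finite F" "F \<subseteq> C" for F
    proof -
      \<comment> \<open>enlarging \<open>F\<close> by \<open>c\<close> makes the section of \<open>c\<close> at \<open>\<one>\<close> a letter\<close>
      let ?F = "insert c F"
      have F': "finite ?F" "?F \<subseteq> C" using F c by auto
      then have "n \<in> fixator (sections ?F)" using n by (simp add: J_def)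
      then have "?a n \<in> fixator (sections ?F)"
        by (rule fixator_section(2)[OF sections_closed[OF F']]) (simp add: section_in_sections)
      then show ?thesis
        using fixator_antimono[OF sections_closed[OF F] sections_closed[OF F'] sections_mono] by blast
    qed
    show "?u \<in> J"
      using uG in_N cK
      by (auto simp: J_def intro!: normal.inv_op_closed2[OF fixator_normal[OF sections_closed]])
    have an: "?a (n \<otimes> x) = ?a n \<otimes> ?a x" if "x \<in> carrier G" for x
    proof (rule fixator_mult[OF sections_closed, of "{c}"])
      show "n \<in> fixator (sections {c})" using n c by (simp add: J_def)
    qed (use c that in \<open>auto simp: section_in_sections\<close>)
    have "c (n \<otimes> x) = ?u \<otimes> c x" if x: "x \<in> carrier G" for x
    proof -
      have split: "c y = c \<one> \<otimes> ?a y" if "y \<in> carrier G" for y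
        using cK that by (simp add: section_apply)
      have "c (n \<otimes> x) = c \<one> \<otimes> (?a n \<otimes> ?a x)"
        using split[of "n \<otimes> x"] an[OF x] nG x by simp
      moreover have "inv (c \<one>) \<otimes> c x = ?a x" using cK x by (simp add: section_apply)
      moreover have "?u \<otimes> c x = c \<one> \<otimes> (?a n \<otimes> (inv (c \<one>) \<otimes> c x))"
        using cK aK nG x by (simp add: m_assoc del: mult_inv_cancel)
      ultimately show ?thesis by simp
    qed
    then show "c \<otimes>\<^bsub>K\<^esub> L n \<otimes>\<^bsub>K\<^esub> inv\<^bsub>K\<^esub> c = L ?u"
      using cK nG uG by (intro aut_eqI) (simp_all add: aut_mult del: L.hom_mult L.hom_inv)
  qed
  have LJ: "L ` J \<subseteq> carrier K" using subgroup.subset[OF J] L.hom_closed by blast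
  have "c \<in> normalizer K (L ` J)" if c: "c \<in> C" for c
  proof -
    have cK: "c \<in> carrier K" using c by (rule C_closed)
    have "L n \<in> (\<lambda>x. c \<otimes>\<^bsub>K\<^esub> x \<otimes>\<^bsub>K\<^esub> inv\<^bsub>K\<^esub> c) ` L ` J" if n: "n \<in> J" for n
    proof
      have nG: "n \<in> carrier G" using n by (simp add: J_def)
      show "inv\<^bsub>K\<^esub> c \<otimes>\<^bsub>K\<^esub> L n \<otimes>\<^bsub>K\<^esub> c \<in> L ` J"
        using conj[OF C_inv[OF c] n] cK by simp
      show "L n = c \<otimes>\<^bsub>K\<^esub> (inv\<^bsub>K\<^esub> c \<otimes>\<^bsub>K\<^esub> L n \<otimes>\<^bsub>K\<^esub> c) \<otimes>\<^bsub>K\<^esub> inv\<^bsub>K\<^esub> c"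
        using cK nG by (simp add: L.H.m_assoc)
    qed
    then have "(\<lambda>x. c \<otimes>\<^bsub>K\<^esub> x \<otimes>\<^bsub>K\<^esub> inv\<^bsub>K\<^esub> c) ` L ` J = L ` J" using conj[OF c] by blast
    then show ?thesis using LJ cK by (simp add: mem_normalizer_iff conj_set)
  qed
  then have "comm_normalised G S J" using J by (auto simp: comm_normalised_def)
  then have "J \<subseteq> D_subgroup G S" by (rule D_subgroup_greatest(2)[OF is_group S_closed])
  then show ?thesis using g all by (auto simp: J_def)
qed

end

section \<open>Quotients of infinite index\<close>

context cayley
begin

primrec ball :: "nat \<Rightarrow> 'a set" where
  "ball 0 = {\<one>}"
| "ball (Suc n) = {b \<otimes> t | b t. b \<in> ball n \<and> t \<in> insert \<one> T}"

lemma ball_closed: "ball n \<subseteq> carrier G"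
  using T_closed by (induction n) auto

lemma ball_finite: "finite (ball n)"
proof (induction n)
  case (Suc n)
  have "ball (Suc n) = (\<lambda>(b, t). b \<otimes> t) ` (ball n \<times> insert \<one> T)" by auto
  then show ?case using Suc T_finite by simp
qed simp

lemma ball_exhausts:
  assumes "g \<in> carrier G"
  obtains n where "g \<in> ball n"
proof -
  have step: "\<exists>m. b \<otimes> t \<in> ball m" if "b \<in> ball n" "t \<in> T" for b t n
    using that by (intro exI[of _ "Suc n"]) auto
  have "\<exists>m. b \<otimes> h \<in> ball m" if "h \<in> generate G T" "b \<in> ball n" for b h n
    using that
  proof (induction h arbitrary: b n)
    case one
    then show ?case using ball_closed by (metis r_one subsetD)
  next
    case (eng h k)
    then obtain m where "b \<otimes> h \<in> ball m" by blast
    then obtain m' where "b \<otimes> h \<otimes> k \<in> ball m'" using eng by blast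
    moreover have "b \<in> carrier G" "h \<in> carrier G" "k \<in> carrier G"
      using eng subsetD[OF ball_closed] T_generates by auto
    ultimately show ?case by (metis m_assoc)
  qed (use step T_inv in blast)+
  from this[of g \<one> 0] show thesis using assms T_generates that by auto
qed

lemma aut_ball:
  assumes a: "a \<in> carrier K" "a \<one> = \<one>"
  shows "x \<in> ball n \<Longrightarrow> a x \<in> ball n"
proof (induction n arbitrary: x)
  case (Suc n)
  then obtain b t where b: "b \<in> ball n" and t: "t \<in> insert \<one> T" and x: "x = b \<otimes> t" by auto
  have bG: "b \<in> carrier G" and tG: "t \<in> carrier G" using b t ball_closed T_closed by auto
  have "inv (a b) \<otimes> a (b \<otimes> t) \<in> insert \<one> T"
    using aut_edge[OF a(1) bG, of t] t a(1) bG by auto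
  moreover have "a x = a b \<otimes> (inv (a b) \<otimes> a (b \<otimes> t))" using x a(1) bG tG by simp
  ultimately show ?case using Suc.IH[OF b] by auto
qed (use a in simp)

text \<open>The multiplicativity gives \<open>p n\<close> from \<open>p (n \<otimes> x)\<close> and \<open>p x\<close>.  Let \<open>X\<close> represent all cosets
  of \<open>N\<close> and let \<open>b = n \<otimes> x\<close> with \<open>x \<in> X\<close>.  Then the neighbour \<open>b \<otimes> t = n \<otimes> (x \<otimes> t)\<close> of \<open>b\<close> is sent to
  \<open>p n \<otimes> p (x \<otimes> t)\<close>, so \<open>p\<close> is determined along paths starting at \<open>\<one>\<close> by its values on the finite
  set \<open>E\<close> of elements of \<open>X\<close> and their neighbours.\<close>

lemma finite_automorphisms:
  assumes N: "N \<lhd> G" and fin: "finite (rcosets N)"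
    and P: "\<And>p. p \<in> P \<Longrightarrow> p \<in> carrier K \<and> p \<one> = \<one>"
    and mult: "\<And>p n x. p \<in> P \<Longrightarrow> n \<in> N \<Longrightarrow> x \<in> carrier G \<Longrightarrow> p (n \<otimes> x) = p n \<otimes> p x"
  shows "finite P"
proof -
  interpret N: normal N G by (rule N)
  have "\<exists>X. finite X \<and> X \<subseteq> carrier G \<and> (\<forall>g\<in>carrier G. \<exists>n\<in>N. \<exists>x\<in>X. g = n \<otimes> x)"
  proof (intro exI conjI ballI)
    let ?X = "(\<lambda>U. SOME x. x \<in> U) ` (rcosets N)"
    show "finite ?X" using fin by simp
    have rep: "(SOME x. x \<in> N #> g) \<in> N #> g" if "g \<in> carrier G" for g
      using rcos_self[OF that N.subgroup_axioms] by (rule someI)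
    then show "?X \<subseteq> carrier G"
      using r_coset_subset_G[OF N.subset] unfolding RCOSETS_def by blast
    fix g assume g: "g \<in> carrier G"
    obtain m where m: "m \<in> N" "(SOME x. x \<in> N #> g) = m \<otimes> g"
      using rep[OF g] unfolding r_coset_def by blast
    show "\<exists>n\<in>N. \<exists>x\<in>?X. g = n \<otimes> x"
    proof (intro bexI)
      show "g = inv m \<otimes> (m \<otimes> g)" using m g by simp
      show "m \<otimes> g \<in> ?X" using m(2) rcosetsI[OF N.subset g] by (metis image_eqI)
    qed (use m in simp)
  qed
  then obtain X where X: "finite X" "X \<subseteq> carrier G"
    and cover: "\<And>g. g \<in> carrier G \<Longrightarrow> \<exists>n\<in>N. \<exists>x\<in>X. g = n \<otimes> x" by blast
  define E where "E = X \<union> {x \<otimes> t | x t. x \<in> X \<and> t \<in> insert \<one> T}"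
  have "E = X \<union> (\<lambda>(x, t). x \<otimes> t) ` (X \<times> insert \<one> T)" by (auto simp: E_def)
  then have finE: "finite E" using X(1) T_finite by simp
  have EG: "E \<subseteq> carrier G" using X(2) T_closed by (auto simp: E_def)
  have "\<forall>e\<in>E. \<exists>n. e \<in> ball n"
  proof
    fix e assume "e \<in> E"
    then obtain n where "e \<in> ball n" using EG ball_exhausts[of e] by blast
    then show "\<exists>n. e \<in> ball n" ..
  qed
  from bchoice[OF this] obtain r where r: "\<And>e. e \<in> E \<Longrightarrow> e \<in> ball (r e)" by blast
  have "(\<lambda>p. restrict p E) ` P \<subseteq> PiE E (\<lambda>e. ball (r e))"
    using P r aut_ball by (auto simp: restrict_def)
  \<comment> \<open>automorphisms fixing \<open>\<one>\<close> preserve balls, so each point of \<open>E\<close> has finitely many possible images\<close>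
  moreover have "finite (PiE E (\<lambda>e. ball (r e)))" using finE ball_finite by (intro finite_PiE)
  ultimately have "finite ((\<lambda>p. restrict p E) ` P)" by (rule finite_subset)
  moreover have "inj_on (\<lambda>p. restrict p E) P"
  proof (rule inj_onI)
    fix p q assume p: "p \<in> P" and q: "q \<in> P" and eq: "restrict p E = restrict q E"
    have eqE: "p e = q e" if "e \<in> E" for e using eq that by (metis restrict_apply')
    have pK: "p \<in> carrier K" "p \<one> = \<one>" and qK: "q \<in> carrier K" "q \<one> = \<one>" using P p q by auto
    have agree: "p g = q g" if "g \<in> ball k" for g k
      using that
    proof (induction k arbitrary: g)
      case (Suc k)
      then obtain b t where b: "b \<in> ball k" and t: "t \<in> insert \<one> T" and g: "g = b \<otimes> t" by auto
      have bG: "b \<in> carrier G" and tG: "t \<in> carrier G" using b t ball_closed T_closed by auto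
      obtain n x where n: "n \<in> N" and x: "x \<in> X" and bnx: "b = n \<otimes> x" using cover[OF bG] by blast
      have nG: "n \<in> carrier G" and xG: "x \<in> carrier G" using n x X(2) by auto
      have "p n \<otimes> p x = q n \<otimes> q x"
        using Suc.IH[OF b] mult[OF p n xG] mult[OF q n xG] by (simp add: bnx)
      moreover have "p x = q x" using x by (intro eqE) (simp add: E_def)
      ultimately have pn: "p n = q n" using nG xG pK(1) qK(1) by simp
      have "p (x \<otimes> t) = q (x \<otimes> t)" using x t by (intro eqE) (auto simp: E_def)
      then have "p (n \<otimes> (x \<otimes> t)) = q (n \<otimes> (x \<otimes> t))"
        using mult[OF p n, of "x \<otimes> t"] mult[OF q n, of "x \<otimes> t"] pn xG tG by simp
      then show ?case using g bnx nG xG tG by (simp add: m_assoc)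
    qed (use pK qK in simp)
    show "p = q"
    proof (rule aut_eqI[OF pK(1) qK(1)])
      fix g assume "g \<in> carrier G"
      then obtain k where "g \<in> ball k" by (rule ball_exhausts)
      then show "p g = q g" by (rule agree)
    qed
  qed
  ultimately show ?thesis by (simp add: finite_image_iff)
qed

text \<open>Inverses in the stabiliser of \<open>\<one>\<close> in the commensurator are those of the full automorphism
  group, so a subgroup of the former that is generated by a set can be treated inside the latter.\<close>

lemma cayley_comm_stab_inv:
  assumes "c \<in> cayley_comm_stab G S"
  shows "inv\<^bsub>K\<^esub> c \<in> cayley_comm_stab G S"
    and "inv\<^bsub>K\<lparr>carrier := cayley_comm_stab G S\<rparr>\<^esub> c = inv\<^bsub>K\<^esub> c"
proof -
  have mem: "c \<in> cayley_comm_stab G S \<longleftrightarrow> c \<in> C \<and> c \<one> = \<one>" for c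
    using C_closed by (auto simp: cayley_comm_stab_def stabilizer_def)
  have c: "c \<in> C" "c \<one> = \<one>" using assms by (simp_all add: mem)
  have cK: "c \<in> carrier K" using c(1) by (rule C_closed)
  have "(inv\<^bsub>K\<^esub> c) \<one> = \<one>" using aut_inv(2)[OF cK one_closed] c(2) by simp
  then show i: "inv\<^bsub>K\<^esub> c \<in> cayley_comm_stab G S" using C_inv[OF c(1)] by (simp add: mem)
  show "inv\<^bsub>K\<lparr>carrier := cayley_comm_stab G S\<rparr>\<^esub> c = inv\<^bsub>K\<^esub> c"
    unfolding m_inv_def[of "K\<lparr>carrier := cayley_comm_stab G S\<rparr>"]
  proof (rule the_equality)
    show "inv\<^bsub>K\<^esub> c \<in> carrier (K\<lparr>carrier := cayley_comm_stab G S\<rparr>) \<and>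
      c \<otimes>\<^bsub>K\<lparr>carrier := cayley_comm_stab G S\<rparr>\<^esub> inv\<^bsub>K\<^esub> c = \<one>\<^bsub>K\<lparr>carrier := cayley_comm_stab G S\<rparr>\<^esub> \<and>
      inv\<^bsub>K\<^esub> c \<otimes>\<^bsub>K\<lparr>carrier := cayley_comm_stab G S\<rparr>\<^esub> c = \<one>\<^bsub>K\<lparr>carrier := cayley_comm_stab G S\<rparr>\<^esub>"
      using i cK by simp
  next
    fix y assume y: "y \<in> carrier (K\<lparr>carrier := cayley_comm_stab G S\<rparr>) \<and>
      c \<otimes>\<^bsub>K\<lparr>carrier := cayley_comm_stab G S\<rparr>\<^esub> y = \<one>\<^bsub>K\<lparr>carrier := cayley_comm_stab G S\<rparr>\<^esub> \<and>
      y \<otimes>\<^bsub>K\<lparr>carrier := cayley_comm_stab G S\<rparr>\<^esub> c = \<one>\<^bsub>K\<lparr>carrier := cayley_comm_stab G S\<rparr>\<^esub>"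
    then have "y \<in> carrier K" using C_closed by (simp add: mem)
    then show "y = inv\<^bsub>K\<^esub> c" using L.H.inv_equality[of y c] y cK by simp
  qed
qed

text \<open>Elements of \<open>E\<close> and their inverses fix \<open>\<one>\<close>, hence are their own sections at \<open>\<one>\<close> and
  occur among the letters.  Being multiplicative over the fixator and preserving it are properties
  that pass to products, so they hold throughout the group generated by \<open>E\<close>.\<close>

lemma fixator_infinite_index:
  assumes F: "finite F" "F \<subseteq> C"
    and E: "E \<subseteq> cayley_comm_stab G S" "E \<subseteq> F" "m_inv K ` E \<subseteq> F"
    and inf: "infinite (generate (K\<lparr>carrier := cayley_comm_stab G S\<rparr>) E)"
  shows "infinite (rcosets (fixator (sections F)))"
proof
  let ?Q = "sections F" and ?P = "generate (K\<lparr>carrier := cayley_comm_stab G S\<rparr>) E"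
  let ?N = "fixator ?Q"
  assume fin: "finite (rcosets ?N)"
  note Q = sections_closed[OF F]
  interpret N: normal ?N G by (rule fixator_normal[OF Q])
  define good where "good p \<longleftrightarrow> p \<in> carrier K \<and> p \<one> = \<one> \<and> (\<forall>n\<in>?N. p n \<in> ?N) \<and>
    (\<forall>n\<in>?N. \<forall>x\<in>carrier G. p (n \<otimes> x) = p n \<otimes> p x)" for p
  have goodQ: "good a" if "a \<in> ?Q" for a
    using that Q fixator_section(2)[OF Q] fixator_mult[OF Q]
    by (auto simp: good_def section_closed_set_def)
  have goodF: "good c" if "c \<in> F" "c \<one> = \<one>" for c
  proof -
    have "c \<in> carrier K" using that F C_closed by blast
    then have "section_at c \<one> = c" using that(2) by (rule section_one)
    then show ?thesis using section_in_sections[OF that(1) one_closed] goodQ by simp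
  qed
  have stab: "c \<one> = \<one>" if "c \<in> cayley_comm_stab G S" for c
    using that by (simp add: cayley_comm_stab_def stabilizer_def)
  have good: "good p" if "p \<in> ?P" for p
    using that
  proof induction
    case one
    have "p \<in> carrier G" if "p \<in> ?N" for p using that by (rule N.mem_carrier)
    then show ?case by (auto simp: good_def aut_one)
  next
    case (incl c)
    then show ?case using E stab by (intro goodF) auto
  next
    case (inv c)
    then have c: "c \<in> cayley_comm_stab G S" using E by blast
    have "inv\<^bsub>K\<^esub> c \<in> F" using inv E(3) by blast
    then show ?case
      using cayley_comm_stab_inv[OF c] stab goodF by simp
  next
    case (eng p q)
    then have pq: "good p" "good q" by auto
    then have "(p \<otimes>\<^bsub>K\<^esub> q) x = p (q x)" if "x \<in> carrier G" for x
      using that by (simp add: good_def aut_mult)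
    then show ?case using pq N.mem_carrier by (simp add: good_def)
  qed
  have "finite ?P"
    by (rule finite_automorphisms[OF N.normal_axioms fin]) (use good in \<open>auto simp: good_def\<close>)
  then show False using inf by simp
qed

end

text \<open>The fixator avoiding \<open>g\<close> and the one of infinite index are combined by taking the union of
  the two finite sets of automorphisms.\<close>

theorem theoremA:
  fixes G :: "('a, 'b) monoid_scheme" and S :: "'a set"
  assumes "group G"
    and "finite S" and "S \<subseteq> carrier G" and "generate G S = carrier G"
    and "\<not> locally_finite_group
           ((aut_group (cayley_graph G S))\<lparr>carrier := cayley_comm_stab G S\<rparr>)"
  shows "\<forall>g \<in> carrier G - D_subgroup G S.
           \<exists>N. N \<lhd> G \<and> D_subgroup G S \<subseteq> N \<and> g \<notin> N \<and>
               infinite (carrier (G Mod N)) \<and> bireversible_group (G Mod N)"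
proof
  fix g assume g: "g \<in> carrier G - D_subgroup G S"
  interpret group G by fact
  interpret cayley G S by unfold_locales (fact assms)+
  obtain E where E: "E \<subseteq> cayley_comm_stab G S" "finite E"
      "infinite (generate (K\<lparr>carrier := cayley_comm_stab G S\<rparr>) E)"
    using assms(5) by (auto simp: locally_finite_group_def)
  obtain F where F: "finite F" "F \<subseteq> C" "g \<notin> fixator (sections F)"
    using fixators_meet_in_D[of g] g by blast
  let ?F = "F \<union> E \<union> m_inv K ` E"
  have EC: "E \<subseteq> C" using E(1) by (auto simp: cayley_comm_stab_def)
  have F': "finite ?F" "?F \<subseteq> C" using F E EC C_inv by auto
  note Q = sections_closed[OF F']
  let ?N = "fixator (sections ?F)"
  show "\<exists>N. N \<lhd> G \<and> D_subgroup G S \<subseteq> N \<and> g \<notin> N \<and>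
      infinite (carrier (G Mod N)) \<and> bireversible_group (G Mod N)"
  proof (intro exI[of _ ?N] conjI)
    show "?N \<lhd> G" by (rule fixator_normal[OF Q])
    show "D_subgroup G S \<subseteq> ?N" by (rule D_subset_fixator[OF F'])
    have "?N \<subseteq> fixator (sections F)"
      by (rule fixator_antimono[OF sections_closed[OF F(1,2)] Q sections_mono]) blast
    then show "g \<notin> ?N" using F(3) by blast
    have "infinite (rcosets\<^bsub>G\<^esub> ?N)"
      by (rule fixator_infinite_index[OF F' E(1) _ _ E(3)]) auto
    then show "infinite (carrier (G Mod ?N))" by (simp add: FactGroup_def)
    show "bireversible_group (G Mod ?N)"
      using automaton_action.bireversible_quotient[OF dual_action[OF Q] dual_bireversible[OF Q]]
        T_closed T_generates by simp
  qed
qed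

end
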